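(* Let $E$ be an elliptic curve without complex multiplication defined over $F=\mathbb{Q}(j(E))$, let $\ell$ be a prime, and let $G=G(E,\ell)$. The level of any fiber of $G$ is at most the level of the $\ell$-adic Galois representation of $E$.
   Context: For $N\ge 1$, $X_1(N)$ is the modular curve over $\mathbb{Q}$ whose non-cuspidal points over $\overline{\mathbb{Q}}$ are isomorphism classes of pairs $(E,P)$, $E$ an elliptic curve and $P\in E$ a point of exact order $N$ ($X_1(1)$ is the $j$-line). $[E,P]$ denotes the closed point given by the $\mathrm{Gal}(\overline{\mathbb{Q}}/\mathbb{Q})$-orbit of $(E,P)$. The natural map $X_1(\ell^{m+1})\to X_1(\ell^m)$ sends $(E,P)$ to $(E,\ell P)$. The tree $G(E,\ell)$: its vertices are the closed points on the curves $X_1(\ell^m)$, $m\ge 0$, lying over the closed point of $X_1(1)$ corresponding to $j(E)$; that closed point is the root. There is a directed edge from a vertex $u$ on $X_1(\ell^m)$ to each vertex $v$ on $X_1(\ell^{m+1})$ whose image under the natural map is $u$ (then $v$ is a child of $u$). A fiber of $G(E,\ell)$ is an infinite path $v_0,v_1,v_2,\dots$ starting at the root, with $v_{m+1}$ a child of $v_m$. The level of a fiber is the level of the point at which the fiber stops branching, i.e. it is $\ell^k$ where $k\ge 0$ is the smallest integer such that $v_m$ has exactly one child for every $m\ge k$. The $\ell$-adic Galois representation $\rho_{E,\ell^\infty}:\mathrm{Gal}(\overline F/F)\to \mathrm{Aut}(T_\ell(E))\cong \mathrm{GL}_2(\mathbb{Z}_\ell)$ arises from the Galois action on the $\ell$-power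 torsion of $E$, and $\rho_{E,\ell^d}$ is its reduction mod $\ell^d$. Its level is the smallest integer $\ell^d$ such that $\mathrm{im}(\rho_{E,\ell^\infty})=\pi_d^{-1}(\mathrm{im}(\rho_{E,\ell^d}))$, where $\pi_d:\mathrm{GL}_2(\mathbb{Z}_\ell)\to \mathrm{GL}_2(\mathbb{Z}/\ell^d\mathbb{Z})$ is reduction. (It is finite for non-CM $E$ by Serre's open image theorem.) *)

theory Defs
  imports
    "HOL-Analysis.Determinants"
    "HOL-Library.Extended_Nat"
    "HOL-Computational_Algebra.Primes"
    "HOL-Algebra.Elementary_Groups"
    "HOL-Algebra.Generated_Fields"
    "HOL-Algebra.Algebraic_Closure_Type"
begin

section \<open>Elliptic curves in Weierstrass form\<close>

text \<open>
  \<open>Weierstrass a1 a2 a3 a4 a6\<close> is the projective curve with affine equation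
  \<open>y\<^sup>2 + a1 x y + a3 y = x\<^sup>3 + a2 x\<^sup>2 + a4 x + a6\<close>; its only point at infinity is
  \<open>[0:1:0]\<close>, which is the origin of the group law.
\<close>

datatype 'a weierstrass = Weierstrass 'a 'a 'a 'a 'a

datatype 'a ell_point = Infinity | Affine 'a 'a

fun discriminant :: "'a::field weierstrass \<Rightarrow> 'a" where
  "discriminant (Weierstrass a1 a2 a3 a4 a6) =
    (let b2 = a1^2 + 4 * a2;
         b4 = 2 * a4 + a1 * a3;
         b6 = a3^2 + 4 * a6;
         b8 = a1^2 * a6 + 4 * a2 * a6 - a1 * a3 * a4 + a2 * a3^2 - a4^2
     in - (b2^2 * b8) - 8 * b4^3 - 27 * b6^2 + 9 * b2 * b4 * b6)"

definition elliptic_curve :: "'a::field weierstrass \<Rightarrow> bool" where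
  "elliptic_curve E \<longleftrightarrow> discriminant E \<noteq> 0"

fun j_invariant :: "'a::field weierstrass \<Rightarrow> 'a" where
  "j_invariant (Weierstrass a1 a2 a3 a4 a6) =
    (let b2 = a1^2 + 4 * a2;
         b4 = 2 * a4 + a1 * a3;
         c4 = b2^2 - 24 * b4
     in c4^3 / discriminant (Weierstrass a1 a2 a3 a4 a6))"

fun on_curve :: "'a::field weierstrass \<Rightarrow> 'a ell_point \<Rightarrow> bool" where
  "on_curve E Infinity \<longleftrightarrow> True"
| "on_curve (Weierstrass a1 a2 a3 a4 a6) (Affine x y) \<longleftrightarrow>
     y^2 + a1 * x * y + a3 * y = x^3 + a2 * x^2 + a4 * x + a6"

text \<open>The chord--tangent law; \<open>s\<close> is the slope of the line through the two points.\<close>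

fun curve_add :: "'a::field weierstrass \<Rightarrow> 'a ell_point \<Rightarrow> 'a ell_point \<Rightarrow> 'a ell_point" where
  "curve_add E Infinity Q = Q"
| "curve_add E P Infinity = P"
| "curve_add (Weierstrass a1 a2 a3 a4 a6) (Affine x1 y1) (Affine x2 y2) =
    (if x1 = x2 \<and> y1 + y2 + a1 * x2 + a3 = 0 then Infinity
     else
      let s = (if x1 = x2
               then (3 * x1^2 + 2 * a2 * x1 + a4 - a1 * y1) / (2 * y1 + a1 * x1 + a3)
               else (y2 - y1) / (x2 - x1));
          x3 = s^2 + a1 * s - a2 - x1 - x2
      in Affine x3 (- (s * (x3 - x1) + y1) - a1 * x3 - a3))"

text \<open>
  The group of points with coordinates in \<open>'a\<close>. It is written multiplicatively by the
  library, so \<open>P [^]\<^bsub>curve_group E\<^esub> n\<close> is the multiple \<open>n P\<close>.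
\<close>

definition curve_group :: "'a::field weierstrass \<Rightarrow> 'a ell_point monoid" where
  "curve_group E = \<lparr>carrier = {P. on_curve E P}, mult = curve_add E, one = Infinity\<rparr>"

definition torsion_group :: "'a::field weierstrass \<Rightarrow> nat \<Rightarrow> 'a ell_point monoid" where
  "torsion_group E n =
    (curve_group E)\<lparr>carrier := {P \<in> carrier (curve_group E). P [^]\<^bsub>curve_group E\<^esub> n = Infinity}\<rparr>"

definition has_exact_order :: "'a::field weierstrass \<Rightarrow> 'a ell_point \<Rightarrow> nat \<Rightarrow> bool" where
  "has_exact_order E P n \<longleftrightarrow>
    P \<in> carrier (curve_group E) \<and> 0 < n \<and> P [^]\<^bsub>curve_group E\<^esub> n = Infinity \<and>
    (\<forall>k. 0 < k \<and> k < n \<longrightarrow> P [^]\<^bsub>curve_group E\<^esub> k \<noteq> Infinity)"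


section \<open>Homomorphisms of elliptic curves\<close>

fun proj_coords :: "'a::field ell_point \<Rightarrow> 'a \<times> 'a \<times> 'a" where
  "proj_coords Infinity = (0, 1, 0)"
| "proj_coords (Affine x y) = (x, y, 1)"

text \<open>
  The value at \<open>(x, y, z)\<close> of the homogeneous polynomial of degree \<open>n\<close> with coefficient
  \<open>c i j\<close> at the monomial \<open>x\<^sup>i y\<^sup>j z\<^sup>n\<^sup>-\<^sup>i\<^sup>-\<^sup>j\<close>.
\<close>

definition form :: "nat \<Rightarrow> (nat \<Rightarrow> nat \<Rightarrow> 'a::field) \<Rightarrow> 'a \<times> 'a \<times> 'a \<Rightarrow> 'a" where
  "form n c = (\<lambda>(x, y, z). \<Sum>i\<le>n. \<Sum>j\<le>n - i. c i j * x^i * y^j * z^(n - i - j))"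

definition form_triple ::
    "nat \<Rightarrow> (nat \<Rightarrow> nat \<Rightarrow> 'a::field) \<times> (nat \<Rightarrow> nat \<Rightarrow> 'a) \<times> (nat \<Rightarrow> nat \<Rightarrow> 'a) \<Rightarrow>
      'a ell_point \<Rightarrow> 'a \<times> 'a \<times> 'a" where
  "form_triple n = (\<lambda>(c, d, e) P.
     (form n c (proj_coords P), form n d (proj_coords P), form n e (proj_coords P)))"

text \<open>
  Morphisms of projective varieties, on points over an algebraically closed field: around
  every point the map is given by homogeneous polynomials of a common degree which do not
  vanish simultaneously.
\<close>

definition curve_morphism ::
    "'a::alg_closed_field weierstrass \<Rightarrow> 'a weierstrass \<Rightarrow> ('a ell_point \<Rightarrow> 'a ell_point) \<Rightarrow> bool" where
  "curve_morphism E E' f \<longleftrightarrow>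
    (\<forall>P. on_curve E P \<longrightarrow> on_curve E' (f P)) \<and>
    (\<forall>P. on_curve E P \<longrightarrow>
      (\<exists>n c. form_triple n c P \<noteq> (0, 0, 0) \<and>
        (\<forall>Q. on_curve E Q \<and> form_triple n c Q \<noteq> (0, 0, 0) \<longrightarrow>
          (\<exists>t. \<forall>x y z. proj_coords (f Q) = (x, y, z) \<longrightarrow>
            form_triple n c Q = (t * x, t * y, t * z)))))"

definition ell_hom ::
    "'a::alg_closed_field weierstrass \<Rightarrow> 'a weierstrass \<Rightarrow> ('a ell_point \<Rightarrow> 'a ell_point) set" where
  "ell_hom E E' = {f \<in> hom (curve_group E) (curve_group E'). curve_morphism E E' f}"

definition ell_iso ::
    "'a::alg_closed_field weierstrass \<Rightarrow> 'a weierstrass \<Rightarrow> ('a ell_point \<Rightarrow> 'a ell_point) set" where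
  "ell_iso E E' = {f \<in> ell_hom E E'. \<exists>g \<in> ell_hom E' E.
     (\<forall>P \<in> carrier (curve_group E). g (f P) = P) \<and>
     (\<forall>Q \<in> carrier (curve_group E'). f (g Q) = Q)}"

text \<open>
  Complex multiplication: an endomorphism over the algebraically closed field which is not
  multiplication by an integer.
\<close>

definition has_CM :: "'a::alg_closed_field weierstrass \<Rightarrow> bool" where
  "has_CM E \<longleftrightarrow>
    (\<exists>f \<in> ell_hom E E. \<forall>n::int. \<exists>P \<in> carrier (curve_group E). f P \<noteq> P [^]\<^bsub>curve_group E\<^esub> n)"


section \<open>Galois action\<close>

type_synonym qbar = "rat alg_closure"

definition adjoin :: "qbar \<Rightarrow> qbar set" where
  "adjoin x = generate_field ring_of_type_algebra {x}"

text \<open>The curve \<open>E\<close>, given by its equation over the algebraic closure, is defined over \<open>K\<close>.\<close>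

definition defined_over :: "'a weierstrass \<Rightarrow> 'a set \<Rightarrow> bool" where
  "defined_over E K \<longleftrightarrow> set_weierstrass E \<subseteq> K"

definition absolute_galois :: "qbar set \<Rightarrow> (qbar \<Rightarrow> qbar) set" where
  "absolute_galois K =
    {\<sigma>. bij \<sigma> \<and> (\<forall>x y. \<sigma> (x + y) = \<sigma> x + \<sigma> y) \<and> (\<forall>x y. \<sigma> (x * y) = \<sigma> x * \<sigma> y) \<and>
        (\<forall>x \<in> K. \<sigma> x = x)}"


section \<open>Closed points of modular curves and the tree\<close>

text \<open>
  The closed point \<open>[E, P]\<close>, as the set of all pairs which are isomorphic over the algebraic
  closure to a Galois conjugate of \<open>(E, P)\<close>.
\<close>

definition closed_point :: "qbar weierstrass \<Rightarrow> qbar ell_point \<Rightarrow> (qbar weierstrass \<times> qbar ell_point) set" where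
  "closed_point E P =
    {(E', P'). elliptic_curve E' \<and> P' \<in> carrier (curve_group E') \<and>
      (\<exists>\<sigma> \<in> absolute_galois \<rat>. \<exists>f \<in> ell_iso (map_weierstrass \<sigma> E) E'.
         f (map_ell_point \<sigma> P) = P')}"

definition X1 :: "nat \<Rightarrow> (qbar weierstrass \<times> qbar ell_point) set set" where
  "X1 N = {closed_point E P | E P. elliptic_curve E \<and> has_exact_order E P N}"

text \<open>The map of closed points induced by \<open>(E, P) \<mapsto> (E, n P)\<close>; the union is over equal sets.\<close>

definition X1_map ::
    "nat \<Rightarrow> (qbar weierstrass \<times> qbar ell_point) set \<Rightarrow> (qbar weierstrass \<times> qbar ell_point) set" where
  "X1_map n x = (\<Union>(E, P) \<in> x. closed_point E (P [^]\<^bsub>curve_group E\<^esub> n))"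

text \<open>A vertex \<open>(m, x)\<close> of the tree is a closed point \<open>x\<close> on \<open>X\<^sub>1(l\<^sup>m)\<close>.\<close>

type_synonym vertex = "nat \<times> (qbar weierstrass \<times> qbar ell_point) set"

definition tree_root :: "qbar weierstrass \<Rightarrow> vertex" where
  "tree_root E = (0, closed_point E Infinity)"

definition tree_verts :: "qbar weierstrass \<Rightarrow> nat \<Rightarrow> vertex set" where
  "tree_verts E l = {(m, x). x \<in> X1 (l^m) \<and> X1_map (l^m) x = closed_point E Infinity}"

definition tree_children :: "qbar weierstrass \<Rightarrow> nat \<Rightarrow> vertex \<Rightarrow> vertex set" where
  "tree_children E l = (\<lambda>(m, x). {(m', y) \<in> tree_verts E l. m' = Suc m \<and> X1_map l y = x})"

definition is_fiber :: "qbar weierstrass \<Rightarrow> nat \<Rightarrow> (nat \<Rightarrow> vertex) \<Rightarrow> bool" where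
  "is_fiber E l v \<longleftrightarrow> v 0 = tree_root E \<and> (\<forall>m. v (Suc m) \<in> tree_children E l (v m))"

text \<open>As an extended natural number, the level is infinite if the fiber never stops branching.\<close>

definition fiber_level :: "qbar weierstrass \<Rightarrow> nat \<Rightarrow> (nat \<Rightarrow> vertex) \<Rightarrow> enat" where
  "fiber_level E l v = Inf {enat (l^k) | k. \<forall>m\<ge>k. \<exists>!w. w \<in> tree_children E l (v m)}"


section \<open>The adic Galois representation\<close>

text \<open>Matrices over \<open>\<int>/N\<close> have their entries in \<open>{0..<N}\<close>.\<close>

definition GL2_mod :: "nat \<Rightarrow> (int^2^2) set" where
  "GL2_mod N = {A. (\<forall>i j. A $ i $ j \<in> {0..<int N}) \<and> coprime (det A) (int N)}"

definition reduce_matrix :: "nat \<Rightarrow> int^2^2 \<Rightarrow> int^2^2" where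
  "reduce_matrix N A = (\<chi> i j. A $ i $ j mod int N)"

text \<open>
  \<open>GL\<^sub>2(\<int>\<^sub>l)\<close> as the inverse limit of the groups \<open>GL\<^sub>2(\<int>/l\<^sup>n)\<close>; the reduction \<open>\<pi>\<^sub>d\<close> maps \<open>A\<close> to
  \<open>A d\<close>.
\<close>

definition GL2_adic :: "nat \<Rightarrow> (nat \<Rightarrow> int^2^2) set" where
  "GL2_adic l = {A. \<forall>n. A n \<in> GL2_mod (l^n) \<and> reduce_matrix (l^n) (A (Suc n)) = A n}"

abbreviation zmod2 :: "nat \<Rightarrow> (int \<times> int) monoid" where
  "zmod2 N \<equiv> integer_mod_group N \<times>\<times> integer_mod_group N"

text \<open>
  An identification of the Tate module \<open>T\<^sub>l(E)\<close> with \<open>\<int>\<^sub>l\<^sup>2\<close>: isomorphisms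
  \<open>(\<int>/l\<^sup>n)\<^sup>2 \<cong> E[l\<^sup>n]\<close> compatible with the transition maps of the two inverse systems, which
  are reduction and multiplication by \<open>l\<close>.
\<close>

definition tate_basis ::
    "qbar weierstrass \<Rightarrow> nat \<Rightarrow> (nat \<Rightarrow> int \<times> int \<Rightarrow> qbar ell_point) \<Rightarrow> bool" where
  "tate_basis E l \<phi> \<longleftrightarrow>
    (\<forall>n. \<phi> n \<in> iso (zmod2 (l^n)) (torsion_group E (l^n))) \<and>
    (\<forall>n. \<forall>(a, b) \<in> carrier (zmod2 (l^Suc n)).
       \<phi> (Suc n) (a, b) [^]\<^bsub>curve_group E\<^esub> l = \<phi> n (a mod int (l^n), b mod int (l^n)))"

text \<open>
  The matrix of \<open>\<sigma>\<close> on \<open>E[l\<^sup>n]\<close>: its columns are the coordinates of the images of the two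
  basis points. The reduction \<open>1 mod l\<^sup>n\<close> only matters for \<open>n = 0\<close>.
\<close>

definition rho_mod ::
    "nat \<Rightarrow> (nat \<Rightarrow> int \<times> int \<Rightarrow> qbar ell_point) \<Rightarrow> nat \<Rightarrow> (qbar \<Rightarrow> qbar) \<Rightarrow> int^2^2" where
  "rho_mod l \<phi> n \<sigma> =
    (let coords = (\<lambda>P. inv_into (carrier (zmod2 (l^n))) (\<phi> n) P);
         e = 1 mod int (l^n);
         (a, c) = coords (map_ell_point \<sigma> (\<phi> n (e, 0)));
         (b, d) = coords (map_ell_point \<sigma> (\<phi> n (0, e)))
     in vector [vector [a, b], vector [c, d]])"

definition rho_adic ::
    "nat \<Rightarrow> (nat \<Rightarrow> int \<times> int \<Rightarrow> qbar ell_point) \<Rightarrow> (qbar \<Rightarrow> qbar) \<Rightarrow> nat \<Rightarrow> int^2^2" where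
  "rho_adic l \<phi> \<sigma> = (\<lambda>n. rho_mod l \<phi> n \<sigma>)"

text \<open>
  The level of the representation of the Galois group of \<open>K\<close> with respect to the basis \<open>\<phi>\<close>,
  infinite if the image is not the full preimage of any of its reductions.
\<close>

definition galois_level ::
    "qbar set \<Rightarrow> nat \<Rightarrow> (nat \<Rightarrow> int \<times> int \<Rightarrow> qbar ell_point) \<Rightarrow> enat" where
  "galois_level K l \<phi> =
    Inf {enat (l^d) | d. rho_adic l \<phi> ` absolute_galois K =
                         {A \<in> GL2_adic l. A d \<in> rho_mod l \<phi> d ` absolute_galois K}}"

end

theory Submission
  imports Defs
begin

text \<open>
  Since \<open>E\<close> sits above the root, every vertex of the tree at level \<open>l\<^sup>m\<close> is \<open>[E, Q]\<close> for some point
  \<open>Q\<close> of exact order \<open>l\<^sup>m\<close>. If \<open>[E, Q]\<close> and \<open>[E, Q']\<close> are children of the same vertex, there are a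
  Galois element \<open>\<sigma>\<close> and an isomorphism \<open>f\<close> from \<open>\<sigma> E\<close> to \<open>E\<close> taking \<open>\<sigma> (l Q)\<close> to \<open>l Q'\<close>. The
  \<open>j\<close>-invariant is an isomorphism invariant, so \<open>\<sigma>\<close> fixes \<open>\<rat>(j(E))\<close>, hence \<open>E\<close>, and without complex
  multiplication \<open>f\<close> is multiplication by an integer \<open>n\<close>, which is prime to \<open>l\<close> because \<open>f\<close> is injective.
  So \<open>n \<rho>(\<sigma>)\<close> maps \<open>Q\<close> to \<open>Q'\<close> in coordinates modulo \<open>l\<^sup>m\<close>. As the vectors are primitive, \<open>\<rho>(\<sigma>)\<close> mod
  \<open>l\<^sup>m\<close> has an invertible lift \<open>B\<close> for which \<open>n B\<close> maps \<open>Q\<close> to \<open>Q'\<close> modulo \<open>l\<^sup>m\<^sup>+\<^sup>1\<close>, and for \<open>m\<close> at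
  least the level of the representation \<open>B\<close> is again the image of a Galois element. Thus
  \<open>[E, Q] = [E, Q']\<close>.

  The group law on \<open>E\<close> is never needed to be associative: on torsion points the Tate basis provides the
  group structure, and elsewhere only inverses and homomorphisms are used.
\<close>

subsection \<open>The chord--tangent law\<close>

text \<open>The second divided difference of the monic cubic at \<open>x1\<close>,
  \<open>x2\<close>, \<open>x3\<close> is \<open>x1 + x2 + x3 + A\<close>, which vanishes. So the
  cubic agrees at \<open>x3\<close> with its linear interpolation through \<open>x1\<close> and
  \<open>x2\<close>, which is zero; if \<open>x1 = x2\<close>, the Taylor expansion at
  \<open>x1\<close> takes its place.\<close>

lemma cubic_third_root:
  fixes A B C :: "'a::field"
  assumes "x1^3 + A * x1^2 + B * x1 + C = 0" "x2^3 + A * x2^2 + B * x2 + C = 0"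
    and "x1 \<noteq> x2 \<or> 3 * x1^2 + 2 * A * x1 + B = 0" and "x1 + x2 + x3 = - A"
  shows "x3^3 + A * x3^2 + B * x3 + C = 0"
proof (cases "x1 = x2")
  case True
  have "x3^3 + A * x3^2 + B * x3 + C = (x1^3 + A * x1^2 + B * x1 + C)
      + (3 * x1^2 + 2 * A * x1 + B) * (x3 - x1) + (x3 - x1)^2 * (x1 + x1 + x3 + A)"
    by (simp add: algebra_simps power2_eq_square power3_eq_cube)
  then show ?thesis using assms True by simp
next
  case False
  have "(x1 - x2) * (x3^3 + A * x3^2 + B * x3 + C) = (x3 - x2) * (x1^3 + A * x1^2 + B * x1 + C)
      - (x3 - x1) * (x2^3 + A * x2^2 + B * x2 + C) + (x1 - x2) * (x3 - x1) * (x3 - x2) * (x1 + x2 + x3 + A)"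
    by (simp add: algebra_simps power2_eq_square power3_eq_cube)
  then show ?thesis using assms False by simp
qed

text \<open>Eliminating \<open>y\<close> turns membership in the curve into a monic cubic in
  \<open>x\<close>. Its quadratic coefficient is what makes the formula for \<open>x3\<close> in
  \<open>curve_add\<close> the third root.\<close>

lemma on_curve_iff_line:
  fixes a1 :: "'a::field"
  assumes "y = s * x + c"
  shows "on_curve (Weierstrass a1 a2 a3 a4 a6) (Affine x y) \<longleftrightarrow>
    x^3 + (a2 - s^2 - a1 * s) * x^2 + (a4 - 2 * s * c - a1 * c - a3 * s) * x + (a6 - c^2 - a3 * c) = 0"
proof -
  have "x^3 + (a2 - s^2 - a1 * s) * x^2 + (a4 - 2 * s * c - a1 * c - a3 * s) * x + (a6 - c^2 - a3 * c)
    = x^3 + a2 * x^2 + a4 * x + a6 - (y^2 + a1 * x * y + a3 * y)"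
    unfolding assms by (simp add: algebra_simps power2_eq_square power3_eq_cube)
  then show ?thesis
    by (simp only: on_curve.simps right_minus_eq) (rule eq_commute)
qed

fun curve_neg :: "'a::field weierstrass \<Rightarrow> 'a ell_point \<Rightarrow> 'a ell_point" where
  "curve_neg E Infinity = Infinity"
| "curve_neg (Weierstrass a1 a2 a3 a4 a6) (Affine x y) = Affine x (- y - a1 * x - a3)"

lemma on_curve_neg [simp]: "on_curve E (curve_neg E P) \<longleftrightarrow> on_curve E P"
proof (cases E; cases P)
  fix a1 a2 a3 a4 a6 x y assume [simp]: "E = Weierstrass a1 a2 a3 a4 a6" "P = Affine x y"
  show ?thesis by (simp add: algebra_simps power2_eq_square)
qed auto

text \<open>Read off from the formula, this gives uniqueness of inverses directly; the usual
  derivation in a group would go through associativity.\<close>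

lemma curve_add_eq_Infinity_iff: "curve_add E P Q = Infinity \<longleftrightarrow> Q = curve_neg E P"
proof (cases E; cases P; cases Q)
  fix a1 a2 a3 a4 a6 x1 y1 x2 y2
  assume [simp]: "E = Weierstrass a1 a2 a3 a4 a6" "P = Affine x1 y1" "Q = Affine x2 y2"
  have "y1 + y2 + a1 * x1 + a3 = 0 \<longleftrightarrow> y2 = - y1 - a1 * x1 - a3"
    using eq_iff_diff_eq_0[of y2 "- y1 - a1 * x1 - a3"] by (simp add: algebra_simps)
  then show ?thesis by (auto simp: Let_def)
qed auto

lemma curve_add_neg [simp]: "curve_add E P (curve_neg E P) = Infinity"
  by (simp add: curve_add_eq_Infinity_iff)

lemma curve_neg_neg [simp]: "curve_neg E (curve_neg E P) = P"
  by (cases E; cases P) auto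

lemma curve_add_neg' [simp]: "curve_add E (curve_neg E P) P = Infinity"
  by (simp add: curve_add_eq_Infinity_iff)

lemma on_curve_add:
  assumes "on_curve E P" "on_curve E Q"
  shows "on_curve E (curve_add E P Q)"
proof (cases "P = Infinity \<or> Q = Infinity \<or> curve_add E P Q = Infinity")
  case True
  moreover have "curve_add E P Infinity = P" by (cases P) auto
  ultimately show ?thesis using assms by auto
next
  case False
  obtain a1 a2 a3 a4 a6 where E: "E = Weierstrass a1 a2 a3 a4 a6" by (cases E)
  have "P \<noteq> Infinity" "Q \<noteq> Infinity" using False by simp_all
  then obtain x1 y1 x2 y2 where P: "P = Affine x1 y1" and Q: "Q = Affine x2 y2"
    by (cases P; cases Q) simp_all
  define s where "s = (if x1 = x2 then (3 * x1^2 + 2 * a2 * x1 + a4 - a1 * y1) / (2 * y1 + a1 * x1 + a3)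
               else (y2 - y1) / (x2 - x1))"
  define c where "c = y1 - s * x1"
  define x3 where "x3 = s^2 + a1 * s - a2 - x1 - x2"
  have nv: "\<not> (x1 = x2 \<and> y1 + y2 + a1 * x2 + a3 = 0)"
  proof
    assume "x1 = x2 \<and> y1 + y2 + a1 * x2 + a3 = 0"
    then have "curve_add E P Q = Infinity" by (simp only: E P Q curve_add.simps simp_thms if_True)
    then show False using False by simp
  qed
  \<comment> \<open>The sum is the negative of the third intersection point of the curve with the
    line of slope \<open>s\<close> and intercept \<open>c\<close>.\<close>
  have add: "curve_add E P Q = curve_neg E (Affine x3 (s * x3 + c))"
  proof -
    have "- (s * (x3 - x1) + y1) - a1 * x3 - a3 = - (s * x3 + c) - a1 * x3 - a3"
      by (simp add: c_def algebra_simps)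
    then show ?thesis
      using nv by (simp only: E P Q curve_add.simps Let_def s_def[symmetric] x3_def[symmetric]
          curve_neg.simps if_False)
  qed
  \<comment> \<open>Subtracting the two curve equations at a common \<open>x\<close> leaves a
    product, whose second factor is nonzero by \<open>nv\<close>.\<close>
  have eq: "y2 = y1" if "x1 = x2"
  proof -
    have "(y1 - y2) * (y1 + y2 + a1 * x2 + a3) = 0"
      using assms that by (simp add: E P Q algebra_simps power2_eq_square)
    then show ?thesis using nv that by auto
  qed
  have y1: "y1 = s * x1 + c" by (simp add: c_def)
  have y2: "y2 = s * x2 + c"
  proof (cases "x1 = x2")
    case True
    then show ?thesis using eq by (simp add: c_def)
  next
    case False
    then have "s * (x2 - x1) = y2 - y1" by (simp add: s_def)
    then show ?thesis by (simp add: c_def algebra_simps)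
  qed
  \<comment> \<open>The tangent slope makes the derivative of the intersection cubic vanish, so
    \<open>x1\<close> counts as a double root.\<close>
  have tangent: "3 * x1^2 + 2 * (a2 - s^2 - a1 * s) * x1 + (a4 - 2 * s * c - a1 * c - a3 * s) = 0"
    if "x1 = x2"
  proof -
    have "s * (2 * y1 + a1 * x1 + a3) = 3 * x1^2 + 2 * a2 * x1 + a4 - a1 * y1"
    proof -
      have "2 * y1 + a1 * x1 + a3 \<noteq> 0"
        using that nv eq[OF that] by simp
      then show ?thesis using that by (simp add: s_def)
    qed
    then show ?thesis by (simp add: c_def algebra_simps power2_eq_square)
  qed
  note line = on_curve_iff_line[of _ s _ c a1 a2 a3 a4 a6]
  have h1: "x1^3 + (a2 - s^2 - a1 * s) * x1^2 + (a4 - 2 * s * c - a1 * c - a3 * s) * x1 + (a6 - c^2 - a3 * c) = 0"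
    using assms(1) line[OF y1] by (simp only: E P)
  have h2: "x2^3 + (a2 - s^2 - a1 * s) * x2^2 + (a4 - 2 * s * c - a1 * c - a3 * s) * x2 + (a6 - c^2 - a3 * c) = 0"
    using assms(2) line[OF y2] by (simp only: E Q)
  have "x1 + x2 + x3 = - (a2 - s^2 - a1 * s)" by (simp add: x3_def)
  then have "on_curve E (Affine x3 (s * x3 + c))"
    unfolding E line[OF refl] using cubic_third_root[OF h1 h2] tangent by blast
  then show ?thesis by (simp only: add on_curve_neg)
qed

lemma curve_group_simps [simp]:
  "carrier (curve_group E) = {P. on_curve E P}" "mult (curve_group E) = curve_add E"
  "one (curve_group E) = Infinity"
  by (simp_all add: curve_group_def)

lemma curve_inv: "on_curve E P \<Longrightarrow> inv\<^bsub>curve_group E\<^esub> P = curve_neg E P"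
  unfolding m_inv_def
proof (rule the_equality)
  show "Q = curve_neg E P" if "Q \<in> carrier (curve_group E) \<and> P \<otimes>\<^bsub>curve_group E\<^esub> Q = \<one>\<^bsub>curve_group E\<^esub> \<and>
      Q \<otimes>\<^bsub>curve_group E\<^esub> P = \<one>\<^bsub>curve_group E\<^esub>" for Q
    using that curve_add_eq_Infinity_iff[of E P Q] by simp
qed simp

lemma curve_pow_closed: "on_curve E P \<Longrightarrow> on_curve E (P [^]\<^bsub>curve_group E\<^esub> (n::nat))"
  by (induction n) (auto intro: on_curve_add)

text \<open>If the affine doubling formula returned \<open>P\<close>, then \<open>x3 = x\<close>,
  and comparing second coordinates shows that \<open>P\<close> is its own negative, so its double
  would be \<open>Infinity\<close> after all. This is what lets homomorphisms preserve the origin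
  without a cancellation law.\<close>

lemma curve_add_self_eq: "curve_add E P P = P \<Longrightarrow> P = Infinity"
proof (cases E; cases P)
  fix a1 a2 a3 a4 a6 x y assume add: "curve_add E P P = P"
    and E: "E = Weierstrass a1 a2 a3 a4 a6" and P: "P = Affine x y"
  show ?thesis
  proof (rule ccontr)
    assume ne: "P \<noteq> Infinity"
    define s where "s = (3 * x^2 + 2 * a2 * x + a4 - a1 * y) / (2 * y + a1 * x + a3)"
    define x3 where "x3 = s^2 + a1 * s - a2 - x - x"
    have nv: "y + y + a1 * x + a3 \<noteq> 0"
    proof
      assume "y + y + a1 * x + a3 = 0"
      then have "curve_add E P P = Infinity" by (simp only: E P curve_add.simps simp_thms if_True)
      then show False using add ne by simp
    qed
    then have "Affine x3 (- (s * (x3 - x) + y) - a1 * x3 - a3) = Affine x y"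
      using add nv by (simp only: E P curve_add.simps Let_def simp_thms if_True if_False
          s_def[symmetric] x3_def[symmetric])
    then have "y = - y - a1 * x - a3" by auto
    then have "curve_add E P P = Infinity" unfolding curve_add_eq_Infinity_iff E P by simp
    then show False using add ne by simp
  qed
qed auto

lemma curve_hom_Infinity:
  assumes "f \<in> hom (curve_group E) (curve_group E')"
  shows "f Infinity = Infinity"
proof -
  have "f (Infinity \<otimes>\<^bsub>curve_group E\<^esub> Infinity) = f Infinity \<otimes>\<^bsub>curve_group E'\<^esub> f Infinity"
    using assms by (intro hom_mult) auto
  then have "curve_add E' (f Infinity) (f Infinity) = f Infinity" by simp
  then show ?thesis by (rule curve_add_self_eq)
qed

lemma curve_hom_pow:
  assumes "f \<in> hom (curve_group E) (curve_group E')" "on_curve E P"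
  shows "f (P [^]\<^bsub>curve_group E\<^esub> (n::nat)) = f P [^]\<^bsub>curve_group E'\<^esub> n"
  using assms by (induction n) (auto simp: curve_hom_Infinity hom_def curve_pow_closed)

lemma curve_hom_neg:
  assumes "f \<in> hom (curve_group E) (curve_group E')" "on_curve E P"
  shows "f (curve_neg E P) = curve_neg E' (f P)"
proof -
  have "curve_add E' (f P) (f (curve_neg E P)) = f (curve_add E P (curve_neg E P))"
    using assms by (simp add: hom_def del: curve_add_neg)
  then show ?thesis using curve_hom_Infinity[OF assms(1)] by (simp add: curve_add_eq_Infinity_iff)
qed

subsection \<open>Homogeneous polynomial maps\<close>

definition homogeneous :: "nat \<Rightarrow> ('a::field \<times> 'a \<times> 'a \<Rightarrow> 'a) \<Rightarrow> bool" where
  "homogeneous n F \<longleftrightarrow> (\<exists>c. F = form n c)"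

lemma form_apply:
  "form n c (x, y, z) = (\<Sum>i\<le>n. \<Sum>j\<le>n - i. c i j * x^i * y^j * z^(n - i - j))"
  by (simp add: form_def)

lemma homogeneous_add:
  assumes "homogeneous n F" "homogeneous n G"
  shows "homogeneous n (\<lambda>p. F p + G p)"
proof -
  obtain c d where "F = form n c" "G = form n d" using assms by (auto simp: homogeneous_def)
  then have "(\<lambda>p. F p + G p) = form n (\<lambda>i j. c i j + d i j)"
    by (auto simp: form_apply fun_eq_iff sum.distrib distrib_right)
  then show ?thesis by (auto simp: homogeneous_def)
qed

lemma homogeneous_zero: "homogeneous n (\<lambda>_. 0)"
proof -
  have "(\<lambda>_. 0) = form n (\<lambda>_ _. 0)" by (auto simp: form_apply fun_eq_iff)
  then show ?thesis by (auto simp: homogeneous_def)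
qed

lemma homogeneous_sum:
  "(\<And>i. i \<in> I \<Longrightarrow> homogeneous n (F i)) \<Longrightarrow> homogeneous n (\<lambda>p. \<Sum>i\<in>I. F i p)"
  by (induction I rule: infinite_finite_induct) (auto intro: homogeneous_zero homogeneous_add)

lemma homogeneous_monomial:
  assumes "i + j \<le> n"
  shows "homogeneous n (\<lambda>(x, y, z). k * x^i * y^j * z^(n - i - j))"
proof -
  have "form n (\<lambda>i' j'. if i' = i then if j' = j then k else 0 else 0) (x, y, z)
    = k * x^i * y^j * z^(n - i - j)" for x y z
  proof -
    have "form n (\<lambda>i' j'. if i' = i then if j' = j then k else 0 else 0) (x, y, z)
      = (\<Sum>i'\<le>n. if i' = i then \<Sum>j'\<le>n - i. if j' = j then k * x^i * y^j * z^(n - i - j) else 0 else 0)"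
      unfolding form_apply
    proof (intro sum.cong refl)
      fix i'
      show "(\<Sum>j'\<le>n - i'. (if i' = i then if j' = j then k else 0 else 0) * x^i' * y^j' * z^(n - i' - j'))
        = (if i' = i then \<Sum>j'\<le>n - i. if j' = j then k * x^i * y^j * z^(n - i - j) else 0 else 0)"
      proof (cases "i' = i")
        case True
        then show ?thesis by (simp only: True if_True refl) (intro sum.cong refl, simp)
      qed simp
    qed
    also have "\<dots> = k * x^i * y^j * z^(n - i - j)" using assms by simp
    finally show ?thesis .
  qed
  then have "(\<lambda>(x, y, z). k * x^i * y^j * z^(n - i - j))
    = form n (\<lambda>i' j'. if i' = i then if j' = j then k else 0 else 0)"
    by (auto simp: fun_eq_iff)
  then show ?thesis by (auto simp: homogeneous_def)
qed

lemma homogeneous_const: "homogeneous 0 (\<lambda>_. k)"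
  using homogeneous_monomial[of 0 0 0 k] by (simp add: case_prod_unfold)

text \<open>The product is expanded into a sum of monomials of degree \<open>n + m\<close>; closure
  under sums then replaces the computation of convolved coefficients.\<close>

lemma homogeneous_mult:
  assumes "homogeneous n F" "homogeneous m G"
  shows "homogeneous (n + m) (\<lambda>p. F p * G p)"
proof -
  obtain c d where F: "F = form n c" and G: "G = form m d" using assms by (auto simp: homogeneous_def)
  have "F p * G p = (\<Sum>i\<le>n. \<Sum>j\<le>n - i. \<Sum>i'\<le>m. \<Sum>j'\<le>m - i'.
      (\<lambda>(x, y, z). (c i j * d i' j') * x^(i + i') * y^(j + j') * z^((n + m) - (i + i') - (j + j'))) p)"
    for p
  proof (cases p)
    case (fields x y z)
    have "F p * G p = (\<Sum>i\<le>n. \<Sum>j\<le>n - i. c i j * x^i * y^j * z^(n - i - j) * G p)"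
      by (simp only: F fields form_apply sum_distrib_right)
    also have "\<dots> = (\<Sum>i\<le>n. \<Sum>j\<le>n - i. \<Sum>i'\<le>m. \<Sum>j'\<le>m - i'.
        c i j * x^i * y^j * z^(n - i - j) * (d i' j' * x^i' * y^j' * z^(m - i' - j')))"
      by (simp only: G fields form_apply sum_distrib_left)
    also have "\<dots> = (\<Sum>i\<le>n. \<Sum>j\<le>n - i. \<Sum>i'\<le>m. \<Sum>j'\<le>m - i'.
        (c i j * d i' j') * x^(i + i') * y^(j + j') * z^((n + m) - (i + i') - (j + j')))"
    proof (intro sum.cong refl)
      \<comment> \<open>The index bounds keep the truncated subtractions exact, so the exponents of
        \<open>z\<close> add up.\<close>
      fix i j i' j' assume "i \<in> {..n}" "j \<in> {..n - i}" "i' \<in> {..m}" "j' \<in> {..m - i'}"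
      then have "(n + m) - (i + i') - (j + j') = (n - i - j) + (m - i' - j')" by auto
      then show "c i j * x^i * y^j * z^(n - i - j) * (d i' j' * x^i' * y^j' * z^(m - i' - j'))
        = (c i j * d i' j') * x^(i + i') * y^(j + j') * z^((n + m) - (i + i') - (j + j'))"
        by (simp add: power_add)
    qed
    finally show ?thesis by (simp add: fields)
  qed
  then have FG: "(\<lambda>p. F p * G p) = (\<lambda>p. \<Sum>i\<le>n. \<Sum>j\<le>n - i. \<Sum>i'\<le>m. \<Sum>j'\<le>m - i'.
      (\<lambda>(x, y, z). (c i j * d i' j') * x^(i + i') * y^(j + j') * z^((n + m) - (i + i') - (j + j'))) p)"
    by (rule ext)
  show ?thesis
    unfolding FG by (intro homogeneous_sum homogeneous_monomial) auto
qed

lemma homogeneous_power: "homogeneous n F \<Longrightarrow> homogeneous (k * n) (\<lambda>p. F p ^ k)"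
  by (induction k) (auto intro: homogeneous_const homogeneous_mult)

lemma homogeneous_compose:
  assumes "homogeneous m F" "homogeneous n G" "homogeneous n H" "homogeneous n K"
  shows "homogeneous (m * n) (\<lambda>p. F (G p, H p, K p))"
proof -
  obtain c where F: "F = form m c" using assms by (auto simp: homogeneous_def)
  have "homogeneous (m * n) (\<lambda>p. c i j * G p^i * H p^j * K p^(m - i - j))"
    if "i \<in> {..m}" "j \<in> {..m - i}" for i j
  proof -
    have "m * n = 0 + i * n + j * n + (m - i - j) * n"
      using that by (auto simp flip: distrib_right)
    moreover have "homogeneous (0 + i * n + j * n + (m - i - j) * n) (\<lambda>p. c i j * G p^i * H p^j * K p^(m - i - j))"
      by (intro homogeneous_mult homogeneous_power homogeneous_const assms)
    ultimately show ?thesis by simp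
  qed
  then show ?thesis unfolding F form_apply by (intro homogeneous_sum)
qed

lemma form_scale: "form n c (t * x, t * y, t * z) = t^n * form n c (x, y, z)"
proof -
  have "c i j * (t * x)^i * (t * y)^j * (t * z)^(n - i - j)
      = t^n * (c i j * x^i * y^j * z^(n - i - j))" if "i \<in> {..n}" "j \<in> {..n - i}" for i j
  proof -
    have "t^n = t^(i + j + (n - i - j))" using that by simp
    then have "t^n = t^i * t^j * t^(n - i - j)" by (simp only: power_add)
    then show ?thesis by (simp add: power_mult_distrib)
  qed
  then show ?thesis unfolding form_apply sum_distrib_left by (intro sum.cong refl)
qed

fun scale3 :: "'a::times \<Rightarrow> 'a \<times> 'a \<times> 'a \<Rightarrow> 'a \<times> 'a \<times> 'a" where
  "scale3 t (x, y, z) = (t * x, t * y, t * z)"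

definition homogeneous_map :: "nat \<Rightarrow> ('a::field \<times> 'a \<times> 'a \<Rightarrow> 'a \<times> 'a \<times> 'a) \<Rightarrow> bool" where
  "homogeneous_map n F \<longleftrightarrow> (\<exists>G H K. homogeneous n G \<and> homogeneous n H \<and> homogeneous n K \<and>
     F = (\<lambda>p. (G p, H p, K p)))"

lemma homogeneous_map_form_triple:
  "homogeneous_map n F \<longleftrightarrow> (\<exists>c d e. F = (\<lambda>p. (form n c p, form n d p, form n e p)))"
  by (auto simp: homogeneous_map_def homogeneous_def)

lemma homogeneous_map_compose:
  "homogeneous_map m F \<Longrightarrow> homogeneous_map n G \<Longrightarrow> homogeneous_map (m * n) (\<lambda>p. F (G p))"
  unfolding homogeneous_map_def
  by (elim exE conjE, hypsubst, intro exI conjI, rule_tac[4] refl)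
    (rule homogeneous_compose; assumption)+

lemma homogeneous_map_scale:
  "homogeneous_map n F \<Longrightarrow> F (scale3 t p) = scale3 (t^n) (F p)"
  by (cases p) (auto simp: homogeneous_map_form_triple form_scale)

lemma homogeneous_map_id: "homogeneous_map 1 (\<lambda>p. p)"
  unfolding homogeneous_map_def
  using homogeneous_monomial[of 1 0 1 1] homogeneous_monomial[of 0 1 1 1] homogeneous_monomial[of 0 0 1 1]
  by (intro exI[of _ "\<lambda>(x, y, z). x"] exI[of _ "\<lambda>(x, y, z). y"] exI[of _ "\<lambda>(x, y, z). z"]) auto

lemma scale3_scale3 [simp]: "scale3 s (scale3 t p) = scale3 (s * t) (p :: 'a::field \<times> 'a \<times> 'a)"
  by (cases p) (simp add: mult.assoc)

lemma scale3_eq_0_iff [simp]: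
  "scale3 t p = (0, 0, 0) \<longleftrightarrow> t = 0 \<or> p = (0, 0, 0 :: 'a::field)"
  by (cases p) auto

lemma proj_coords_nonzero [simp]: "proj_coords P \<noteq> (0, 0, 0)"
  by (cases P) auto

section \<open>Morphisms through local homogeneous representatives\<close>

definition represents ::
    "'a::field weierstrass \<Rightarrow> ('a ell_point \<Rightarrow> 'a ell_point) \<Rightarrow> ('a \<times> 'a \<times> 'a \<Rightarrow> 'a \<times> 'a \<times> 'a) \<Rightarrow> bool" where
  "represents E f F \<longleftrightarrow>
    (\<forall>Q. on_curve E Q \<longrightarrow> (\<exists>t. F (proj_coords Q) = scale3 t (proj_coords (f Q))))"

text \<open>Where the representing polynomials vanish simultaneously, the factor \<open>t\<close> is \<open>0\<close>.\<close>

lemma curve_morphism_iff: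
  "curve_morphism E E' f \<longleftrightarrow>
    (\<forall>P. on_curve E P \<longrightarrow> on_curve E' (f P)) \<and>
    (\<forall>P. on_curve E P \<longrightarrow>
      (\<exists>n F. homogeneous_map n F \<and> F (proj_coords P) \<noteq> (0, 0, 0) \<and> represents E f F))"
proof -
  have scale: "(\<forall>x y z. p = (x, y, z) \<longrightarrow> q = (t * x, t * y, t * z)) \<longleftrightarrow> q = scale3 t p"
    for p q :: "'a \<times> 'a \<times> 'a" and t by (cases p) auto
  have rep: "(\<forall>Q. on_curve E Q \<and> F (proj_coords Q) \<noteq> (0, 0, 0) \<longrightarrow>
        (\<exists>t. F (proj_coords Q) = scale3 t (proj_coords (f Q)))) \<longleftrightarrow> represents E f F" for F
  proof -
    have "(0, 0, 0) = scale3 0 (proj_coords (f Q))" for Q by (cases "proj_coords (f Q)") simp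
    then show ?thesis unfolding represents_def by metis
  qed
  have "(\<exists>n c. form_triple n c P \<noteq> (0, 0, 0) \<and>
        (\<forall>Q. on_curve E Q \<and> form_triple n c Q \<noteq> (0, 0, 0) \<longrightarrow>
          (\<exists>t. form_triple n c Q = scale3 t (proj_coords (f Q)))))
    \<longleftrightarrow> (\<exists>n F. homogeneous_map n F \<and> F (proj_coords P) \<noteq> (0, 0, 0) \<and> represents E f F)" for P
  proof -
    have "(\<exists>n c. form_triple n c P \<noteq> (0, 0, 0) \<and>
        (\<forall>Q. on_curve E Q \<and> form_triple n c Q \<noteq> (0, 0, 0) \<longrightarrow>
          (\<exists>t. form_triple n c Q = scale3 t (proj_coords (f Q)))))
    \<longleftrightarrow> (\<exists>n c d e. (\<lambda>p. (form n c p, form n d p, form n e p)) (proj_coords P) \<noteq> (0, 0, 0) \<and>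
        represents E f (\<lambda>p. (form n c p, form n d p, form n e p)))"
      unfolding rep[symmetric] by (simp add: form_triple_def)
    then show ?thesis unfolding homogeneous_map_form_triple by blast
  qed
  then show ?thesis unfolding curve_morphism_def scale by simp
qed

lemma curve_morphism_compose:
  assumes "curve_morphism E E' f" "curve_morphism E' E'' g"
  shows "curve_morphism E E'' (\<lambda>P. g (f P))"
  unfolding curve_morphism_iff
proof (intro conjI allI impI)
  fix P assume P: "on_curve E P"
  show "on_curve E'' (g (f P))" using P assms by (auto simp: curve_morphism_iff)
  obtain n F where F: "homogeneous_map n F" "F (proj_coords P) \<noteq> (0, 0, 0)" "represents E f F"
    using P assms(1) unfolding curve_morphism_iff by blast
  have fP: "on_curve E' (f Q)" if "on_curve E Q" for Q using that assms by (auto simp: curve_morphism_iff)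
  then obtain m G where G: "homogeneous_map m G" "G (proj_coords (f P)) \<noteq> (0, 0, 0)" "represents E' g G"
    using P assms(2) unfolding curve_morphism_iff by blast
  \<comment> \<open>\<open>G\<close> has degree \<open>m\<close>, so a factor \<open>t\<close> in
    its argument comes out as \<open>t^m\<close>. At \<open>P\<close> this factor is nonzero because
    \<open>F\<close> does not vanish there, hence the composite does not vanish either.\<close>
  have GF: "G (F (proj_coords Q)) = scale3 (t^m) (G (proj_coords (f Q)))"
    if "F (proj_coords Q) = scale3 t (proj_coords (f Q))" for Q t
    using homogeneous_map_scale[OF G(1)] that by simp
  show "\<exists>n F. homogeneous_map n F \<and> F (proj_coords P) \<noteq> (0, 0, 0) \<and> represents E (\<lambda>P. g (f P)) F"
  proof (intro exI conjI)
    show "homogeneous_map (m * n) (\<lambda>p. G (F p))" by (intro homogeneous_map_compose F G)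
    obtain t where t: "F (proj_coords P) = scale3 t (proj_coords (f P))"
      using F P by (auto simp: represents_def)
    then show "G (F (proj_coords P)) \<noteq> (0, 0, 0)" using GF[OF t] G F(2) by auto
    show "represents E (\<lambda>P. g (f P)) (\<lambda>p. G (F p))"
      unfolding represents_def
    proof (intro allI impI)
      fix Q assume Q: "on_curve E Q"
      obtain t where t: "F (proj_coords Q) = scale3 t (proj_coords (f Q))"
        using F Q by (auto simp: represents_def)
      obtain s where s: "G (proj_coords (f Q)) = scale3 s (proj_coords (g (f Q)))"
        using G fP[OF Q] by (auto simp: represents_def)
      show "\<exists>t. G (F (proj_coords Q)) = scale3 t (proj_coords (g (f Q)))"
        using GF[OF t] s by auto
    qed
  qed
qed

lemma curve_morphism_id: "curve_morphism E E (\<lambda>P. P)"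
  unfolding curve_morphism_iff represents_def
proof (intro conjI allI impI exI)
  fix P :: "'a ell_point"
  show "homogeneous_map 1 (\<lambda>p :: 'a \<times> 'a \<times> 'a. p)" by (rule homogeneous_map_id)
  show "proj_coords P = scale3 1 (proj_coords P)" by (cases "proj_coords P") simp
qed auto

lemma ell_hom_compose:
  "f \<in> ell_hom E E' \<Longrightarrow> g \<in> ell_hom E' E'' \<Longrightarrow> (\<lambda>P. g (f P)) \<in> ell_hom E E''"
  by (auto simp: ell_hom_def hom_def Pi_iff intro: curve_morphism_compose)

lemma ell_iso_compose:
  assumes "f \<in> ell_iso E E'" "g \<in> ell_iso E' E''"
  shows "(\<lambda>P. g (f P)) \<in> ell_iso E E''"
proof -
  obtain f' where f: "f \<in> ell_hom E E'" "f' \<in> ell_hom E' E"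
      "\<And>P. on_curve E P \<Longrightarrow> f' (f P) = P" "\<And>P. on_curve E' P \<Longrightarrow> f (f' P) = P"
    using assms(1) by (auto simp: ell_iso_def)
  obtain g' where g: "g \<in> ell_hom E' E''" "g' \<in> ell_hom E'' E'"
      "\<And>P. on_curve E' P \<Longrightarrow> g' (g P) = P" "\<And>P. on_curve E'' P \<Longrightarrow> g (g' P) = P"
    using assms(2) by (auto simp: ell_iso_def)
  have "on_curve E' (f P)" if "on_curve E P" for P using f(1) that by (auto simp: ell_hom_def hom_def)
  moreover have "on_curve E' (g' P)" if "on_curve E'' P" for P using g(2) that by (auto simp: ell_hom_def hom_def)
  ultimately show ?thesis
    unfolding ell_iso_def using f g ell_hom_compose[OF f(1) g(1)] ell_hom_compose[OF g(2) f(2)]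
    by (auto intro!: bexI[of _ "\<lambda>P. f' (g' P)"])
qed

lemma ell_iso_id: "(\<lambda>P. P) \<in> ell_iso E E"
proof -
  have "(\<lambda>P. P) \<in> ell_hom E E" by (auto simp: ell_hom_def hom_def curve_morphism_id)
  then show ?thesis by (auto simp: ell_iso_def)
qed

lemma ell_iso_inverse:
  assumes "f \<in> ell_iso E E'"
  obtains g where "g \<in> ell_iso E' E" "\<And>P. on_curve E P \<Longrightarrow> g (f P) = P"
    "\<And>P. on_curve E' P \<Longrightarrow> f (g P) = P"
  using assms that by (auto simp: ell_iso_def)

subsection \<open>Galois conjugation\<close>

text \<open>In characteristic 0 such maps fix the rationals (\<open>field_aut_Rats\<close>), so on
  \<open>qbar\<close> this is membership in the absolute Galois group of the rationals.\<close>

definition field_aut :: "('a::field \<Rightarrow> 'a) \<Rightarrow> bool" where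
  "field_aut \<sigma> \<longleftrightarrow> bij \<sigma> \<and> (\<forall>x y. \<sigma> (x + y) = \<sigma> x + \<sigma> y) \<and> (\<forall>x y. \<sigma> (x * y) = \<sigma> x * \<sigma> y)"

context
  fixes \<sigma> :: "'a::field \<Rightarrow> 'a"
  assumes \<sigma>: "field_aut \<sigma>"
begin

lemma field_aut_add: "\<sigma> (x + y) = \<sigma> x + \<sigma> y" and field_aut_mult: "\<sigma> (x * y) = \<sigma> x * \<sigma> y"
  and field_aut_bij: "bij \<sigma>"
  using \<sigma> by (auto simp: field_aut_def)

lemma field_aut_eq_iff: "\<sigma> x = \<sigma> y \<longleftrightarrow> x = y"
  using field_aut_bij by (auto simp: bij_def inj_on_def)

lemma field_aut_0: "\<sigma> 0 = 0"
  using field_aut_add[of 0 0] by (simp only: add_0_left add_cancel_right_right)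

lemma field_aut_eq_0_iff: "\<sigma> x = 0 \<longleftrightarrow> x = 0"
  using field_aut_eq_iff[of x 0] by (simp add: field_aut_0)

lemma field_aut_1: "\<sigma> 1 = 1"
  using field_aut_mult[of 1 1] field_aut_eq_0_iff[of 1] by simp

lemma field_aut_minus: "\<sigma> (- x) = - \<sigma> x"
  using field_aut_add[of x "- x"] by (simp add: field_aut_0 eq_neg_iff_add_eq_0 add.commute)

lemma field_aut_diff: "\<sigma> (x - y) = \<sigma> x - \<sigma> y"
  using field_aut_add[of x "- y"] by (simp add: field_aut_minus)

lemma field_aut_inverse: "\<sigma> (inverse x) = inverse (\<sigma> x)"
proof (cases "x = 0")
  case False
  then have "\<sigma> x * \<sigma> (inverse x) = 1" by (simp flip: field_aut_mult add: field_aut_1)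
  then show ?thesis by (metis inverse_unique)
qed (simp add: field_aut_0)

lemma field_aut_divide: "\<sigma> (x / y) = \<sigma> x / \<sigma> y"
  by (simp add: divide_inverse field_aut_mult field_aut_inverse)

lemma field_aut_power: "\<sigma> (x ^ n) = \<sigma> x ^ n"
  by (induction n) (auto simp: field_aut_1 field_aut_mult)

lemma field_aut_of_nat: "\<sigma> (of_nat n) = of_nat n"
  by (induction n) (auto simp: field_aut_0 field_aut_1 field_aut_add)

lemma field_aut_numeral: "\<sigma> (numeral n) = numeral n"
  using field_aut_of_nat[of "numeral n"] by simp

lemma field_aut_sum: "\<sigma> (sum f A) = (\<Sum>a\<in>A. \<sigma> (f a))"
  by (induction A rule: infinite_finite_induct) (auto simp: field_aut_0 field_aut_add)

lemmas field_aut_simps = field_aut_add field_aut_mult field_aut_eq_iff field_aut_0 field_aut_1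
  field_aut_eq_0_iff field_aut_minus field_aut_diff field_aut_divide field_aut_power
  field_aut_numeral field_aut_sum

lemma field_aut_inv: "field_aut (inv_into UNIV \<sigma>)"
proof -
  have s: "\<sigma> (inv_into UNIV \<sigma> x) = x" for x using field_aut_bij by (simp add: bij_is_surj surj_f_inv_f)
  have "inv_into UNIV \<sigma> (\<sigma> x) = x" for x using field_aut_bij by (simp add: bij_is_inj)
  then have "inv_into UNIV \<sigma> (\<sigma> (inv_into UNIV \<sigma> x) + \<sigma> (inv_into UNIV \<sigma> y)) = inv_into UNIV \<sigma> x + inv_into UNIV \<sigma> y"
    "inv_into UNIV \<sigma> (\<sigma> (inv_into UNIV \<sigma> x) * \<sigma> (inv_into UNIV \<sigma> y)) = inv_into UNIV \<sigma> x * inv_into UNIV \<sigma> y" for x y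
    by (simp_all flip: field_aut_add field_aut_mult)
  then show ?thesis using field_aut_bij by (simp add: field_aut_def s bij_imp_bij_inv)
qed

lemma discriminant_map: "discriminant (map_weierstrass \<sigma> E) = \<sigma> (discriminant E)"
  by (cases E) (simp add: Let_def field_aut_simps)

lemma elliptic_curve_map: "elliptic_curve (map_weierstrass \<sigma> E) \<longleftrightarrow> elliptic_curve E"
  by (simp add: elliptic_curve_def discriminant_map field_aut_eq_0_iff)

lemma j_invariant_map: "j_invariant (map_weierstrass \<sigma> E) = \<sigma> (j_invariant E)"
proof (cases E)
  case (Weierstrass a1 a2 a3 a4 a6)
  then show ?thesis
    using discriminant_map[of E] by (simp add: Let_def field_aut_simps del: discriminant.simps)
qed

lemma on_curve_map: "on_curve (map_weierstrass \<sigma> E) (map_ell_point \<sigma> P) \<longleftrightarrow> on_curve E P"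
proof (cases E; cases P)
  fix a1 a2 a3 a4 a6 x y assume "E = Weierstrass a1 a2 a3 a4 a6" "P = Affine x y"
  then show ?thesis by (simp flip: field_aut_add field_aut_mult field_aut_power add: field_aut_eq_iff)
qed auto

lemma curve_add_map:
  "curve_add (map_weierstrass \<sigma> E) (map_ell_point \<sigma> P) (map_ell_point \<sigma> Q)
    = map_ell_point \<sigma> (curve_add E P Q)"
proof (cases E; cases P; cases Q)
  fix a1 a2 a3 a4 a6 x1 y1 x2 y2
  assume *: "E = Weierstrass a1 a2 a3 a4 a6" "P = Affine x1 y1" "Q = Affine x2 y2"
  have "\<sigma> y1 + \<sigma> y2 + \<sigma> a1 * \<sigma> x2 + \<sigma> a3 = 0 \<longleftrightarrow> y1 + y2 + a1 * x2 + a3 = 0"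
    by (simp flip: field_aut_add field_aut_mult add: field_aut_eq_0_iff)
  then show ?thesis
    unfolding * weierstrass.map ell_point.map curve_add.simps field_aut_eq_iff Let_def
    by (simp add: field_aut_simps del: numeral_times_minus_swap)
qed auto

lemma curve_pow_map:
  "map_ell_point \<sigma> P [^]\<^bsub>curve_group (map_weierstrass \<sigma> E)\<^esub> (n::nat)
    = map_ell_point \<sigma> (P [^]\<^bsub>curve_group E\<^esub> n)"
  by (induction n) (auto simp: curve_add_map)

lemma form_map: "form n (\<lambda>i j. \<sigma> (c i j)) (\<sigma> x, \<sigma> y, \<sigma> z) = \<sigma> (form n c (x, y, z))"
  by (simp add: form_apply field_aut_simps)

end

context
  fixes \<sigma> :: "'a::field \<Rightarrow> 'a"
  assumes \<sigma>: "field_aut \<sigma>"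
begin

lemma field_aut_inv_left: "inv_into UNIV \<sigma> (\<sigma> x) = x"
  and field_aut_inv_right: "\<sigma> (inv_into UNIV \<sigma> x) = x"
  using field_aut_bij[OF \<sigma>] by (simp_all add: bij_is_inj bij_is_surj surj_f_inv_f)

lemma map_field_aut_inv [simp]:
  "map_ell_point (inv_into UNIV \<sigma>) (map_ell_point \<sigma> P) = P"
  "map_ell_point \<sigma> (map_ell_point (inv_into UNIV \<sigma>) P) = P"
  "map_weierstrass (inv_into UNIV \<sigma>) (map_weierstrass \<sigma> E) = E"
  "map_weierstrass \<sigma> (map_weierstrass (inv_into UNIV \<sigma>) E) = E"
  by (simp_all add: ell_point.map_comp weierstrass.map_comp o_def field_aut_inv_left
      field_aut_inv_right ell_point.map_ident weierstrass.map_ident)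

lemma on_curve_map_inv:
  "on_curve E (map_ell_point (inv_into UNIV \<sigma>) P) \<longleftrightarrow> on_curve (map_weierstrass \<sigma> E) P"
  using on_curve_map[OF \<sigma>, of E "map_ell_point (inv_into UNIV \<sigma>) P"] by simp

text \<open>This is \<open>curve_add_map\<close> for the inverse automorphism. The second context
  exists for such uses: the facts of the first one are general in \<open>\<sigma>\<close> only after
  it is closed.\<close>

lemma curve_add_map_inv:
  "map_ell_point (inv_into UNIV \<sigma>) (curve_add (map_weierstrass \<sigma> E) P Q)
    = curve_add E (map_ell_point (inv_into UNIV \<sigma>) P) (map_ell_point (inv_into UNIV \<sigma>) Q)"
  using curve_add_map[OF field_aut_inv[OF \<sigma>], of "map_weierstrass \<sigma> E" P Q] by simp

lemma field_aut_map_scale3: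
  "map_prod \<sigma> (map_prod \<sigma> \<sigma>) (scale3 t p) = scale3 (\<sigma> t) (map_prod \<sigma> (map_prod \<sigma> \<sigma>) p)"
  by (cases p) (simp add: field_aut_mult[OF \<sigma>])

lemma proj_coords_map:
  "proj_coords (map_ell_point \<sigma> P) = map_prod \<sigma> (map_prod \<sigma> \<sigma>) (proj_coords P)"
  by (cases P) (simp_all add: field_aut_simps[OF \<sigma>])

text \<open>Although \<open>\<sigma>\<close> is not polynomial, conjugating a form by it merely
  applies \<open>\<sigma>\<close> to the coefficients, so conjugates of morphisms are again given by
  forms of the same degree.\<close>

lemma homogeneous_map_conj:
  assumes "homogeneous_map n F"
  shows "homogeneous_map n (\<lambda>p. map_prod \<sigma> (map_prod \<sigma> \<sigma>)
    (F (map_prod (inv_into UNIV \<sigma>) (map_prod (inv_into UNIV \<sigma>) (inv_into UNIV \<sigma>)) p)))"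
proof -
  obtain c d e where F: "F = (\<lambda>p. (form n c p, form n d p, form n e p))"
    using assms unfolding homogeneous_map_form_triple by blast
  have "\<sigma> (form n c (map_prod (inv_into UNIV \<sigma>) (map_prod (inv_into UNIV \<sigma>) (inv_into UNIV \<sigma>)) p))
    = form n (\<lambda>i j. \<sigma> (c i j)) p" for c p
    by (cases p) (simp add: form_map[OF \<sigma>, symmetric] field_aut_inv_right)
  then show ?thesis unfolding homogeneous_map_form_triple F by auto
qed

end

lemma curve_morphism_conj:
  assumes \<sigma>: "field_aut \<sigma>" and f: "curve_morphism E E' f"
  shows "curve_morphism (map_weierstrass \<sigma> E) (map_weierstrass \<sigma> E')
    (\<lambda>P. map_ell_point \<sigma> (f (map_ell_point (inv_into UNIV \<sigma>) P)))"
  unfolding curve_morphism_iff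
proof (intro conjI allI impI)
  let ?\<tau> = "inv_into UNIV \<sigma>"
  let ?f = "\<lambda>P. map_ell_point \<sigma> (f (map_ell_point ?\<tau> P))"
  fix P assume P: "on_curve (map_weierstrass \<sigma> E) P"
  then have P': "on_curve E (map_ell_point ?\<tau> P)" by (simp add: on_curve_map_inv[OF \<sigma>])
  then show "on_curve (map_weierstrass \<sigma> E') (?f P)"
    using f by (auto simp: curve_morphism_iff on_curve_map[OF \<sigma>])
  obtain n F where F: "homogeneous_map n F" "F (proj_coords (map_ell_point ?\<tau> P)) \<noteq> (0, 0, 0)"
      "represents E f F"
    using f P' unfolding curve_morphism_iff by blast
  define F' where "F' = (\<lambda>p. map_prod \<sigma> (map_prod \<sigma> \<sigma>) (F (map_prod ?\<tau> (map_prod ?\<tau> ?\<tau>) p)))"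
  have F'_proj: "F' (proj_coords Q) = map_prod \<sigma> (map_prod \<sigma> \<sigma>) (F (proj_coords (map_ell_point ?\<tau> Q)))" for Q
    by (simp add: F'_def proj_coords_map[OF field_aut_inv[OF \<sigma>]])
  show "\<exists>n F. homogeneous_map n F \<and> F (proj_coords P) \<noteq> (0, 0, 0) \<and> represents (map_weierstrass \<sigma> E) ?f F"
  proof (intro exI conjI)
    show "homogeneous_map n F'" unfolding F'_def by (rule homogeneous_map_conj[OF \<sigma> F(1)])
    show "F' (proj_coords P) \<noteq> (0, 0, 0)"
      using F(2) unfolding F'_proj by (cases "F (proj_coords (map_ell_point ?\<tau> P))")
        (simp add: field_aut_eq_0_iff[OF \<sigma>])
    show "represents (map_weierstrass \<sigma> E) ?f F'"
      unfolding represents_def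
    proof (intro allI impI)
      fix Q assume "on_curve (map_weierstrass \<sigma> E) Q"
      then have "on_curve E (map_ell_point ?\<tau> Q)" by (simp add: on_curve_map_inv[OF \<sigma>])
      then obtain t where "F (proj_coords (map_ell_point ?\<tau> Q)) = scale3 t (proj_coords (f (map_ell_point ?\<tau> Q)))"
        using F(3) unfolding represents_def by blast
      then show "\<exists>t. F' (proj_coords Q) = scale3 t (proj_coords (?f Q))"
        unfolding F'_proj by (auto simp: field_aut_map_scale3[OF \<sigma>] proj_coords_map[OF \<sigma>])
    qed
  qed
qed

lemma ell_hom_conj:
  assumes \<sigma>: "field_aut \<sigma>" and f: "f \<in> ell_hom E E'"
  shows "(\<lambda>P. map_ell_point \<sigma> (f (map_ell_point (inv_into UNIV \<sigma>) P)))
    \<in> ell_hom (map_weierstrass \<sigma> E) (map_weierstrass \<sigma> E')"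
  using f curve_morphism_conj[OF \<sigma>, of E E' f]
  by (auto simp: ell_hom_def hom_def Pi_iff on_curve_map[OF \<sigma>] on_curve_map_inv[OF \<sigma>]
      curve_add_map_inv[OF \<sigma>] curve_add_map[OF \<sigma>])

lemma ell_iso_conj:
  assumes \<sigma>: "field_aut \<sigma>" and f: "f \<in> ell_iso E E'"
  obtains h where "h \<in> ell_iso (map_weierstrass \<sigma> E) (map_weierstrass \<sigma> E')"
    "\<And>P. h (map_ell_point \<sigma> P) = map_ell_point \<sigma> (f P)"
proof
  let ?c = "\<lambda>f P. map_ell_point \<sigma> (f (map_ell_point (inv_into UNIV \<sigma>) P))"
  obtain g where g: "f \<in> ell_hom E E'" "g \<in> ell_hom E' E"
      "\<And>P. on_curve E P \<Longrightarrow> g (f P) = P" "\<And>P. on_curve E' P \<Longrightarrow> f (g P) = P"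
    using f by (auto simp: ell_iso_def)
  then show "?c f \<in> ell_iso (map_weierstrass \<sigma> E) (map_weierstrass \<sigma> E')"
    unfolding ell_iso_def using ell_hom_conj[OF \<sigma>]
    by (auto intro!: bexI[of _ "?c g"] simp: \<sigma> on_curve_map_inv[OF \<sigma>])
  show "?c f (map_ell_point \<sigma> P) = map_ell_point \<sigma> (f P)" for P by (simp add: \<sigma>)
qed

lemma field_aut_Rats:
  fixes \<sigma> :: "'a::field_char_0 \<Rightarrow> 'a"
  assumes \<sigma>: "field_aut \<sigma>" and "x \<in> \<rat>"
  shows "\<sigma> x = x"
proof -
  have int: "\<sigma> (of_int n) = of_int n" for n
    by (cases n) (simp_all add: field_aut_of_nat[OF \<sigma>] field_aut_simps[OF \<sigma>])
  obtain r where "x = of_rat r" using assms(2) by (rule Rats_cases)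
  then show ?thesis by (cases r) (simp add: of_rat_rat int field_aut_divide[OF \<sigma>])
qed

lemma absolute_galois_iff:
  "\<sigma> \<in> absolute_galois K \<longleftrightarrow> field_aut \<sigma> \<and> (\<forall>x \<in> K. \<sigma> x = x)"
  by (auto simp: absolute_galois_def field_aut_def)

text \<open>The elements fixed by an automorphism form a field; the induction over the generation of
  \<open>adjoin x\<close> checks this operation by operation.\<close>

lemma absolute_galois_adjoin:
  assumes "field_aut \<sigma>" "\<sigma> x = x"
  shows "\<sigma> \<in> absolute_galois (adjoin x)"
proof -
  let ?R = "ring_of_type_algebra :: qbar ring"
  interpret field ?R by (rule field_from_type_algebra)
  have neg: "\<ominus>\<^bsub>?R\<^esub> y = - y" for y
    by (rule minus_equality) (auto simp: ring_of_type_algebra_def)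
  \<comment> \<open>The inverse of the ring record is unspecified at 0, so it is compared with the
    type-class inverse at nonzero elements; the induction only inverts those.\<close>
  have inv: "inv\<^bsub>?R\<^esub> y = inverse y" if "y \<noteq> 0" for y
    using that by (intro comm_inv_char) (auto simp: ring_of_type_algebra_def)
  have "\<sigma> y = y" if "y \<in> generate_field ?R {x}" for y
    using that
  proof induction
    case (a_inv h)
    then show ?case by (simp add: neg field_aut_minus[OF assms(1)])
  next
    case (m_inv h)
    then have "h \<noteq> 0" by (simp add: ring_of_type_algebra_def)
    with m_inv show ?case by (simp add: inv field_aut_inverse[OF assms(1)])
  qed (use assms(2) in \<open>auto simp: ring_of_type_algebra_def field_aut_simps[OF assms(1)]\<close>)
  then show ?thesis using assms(1) by (simp add: absolute_galois_iff adjoin_def)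
qed

subsection \<open>Closed points\<close>

lemma closed_point_iff:
  "(E', P') \<in> closed_point E P \<longleftrightarrow> elliptic_curve E' \<and> on_curve E' P' \<and>
    (\<exists>\<sigma> f. field_aut \<sigma> \<and> f \<in> ell_iso (map_weierstrass \<sigma> E) E' \<and> f (map_ell_point \<sigma> P) = P')"
  by (auto simp: closed_point_def absolute_galois_iff field_aut_Rats)

lemma field_aut_comp: "field_aut \<sigma> \<Longrightarrow> field_aut \<tau> \<Longrightarrow> field_aut (\<tau> \<circ> \<sigma>)"
  by (auto simp: field_aut_def bij_comp)

lemma closed_point_refl: "elliptic_curve E \<Longrightarrow> on_curve E P \<Longrightarrow> (E, P) \<in> closed_point E P"
proof -
  have "field_aut (\<lambda>x :: qbar. x)" by (simp add: field_aut_def bij_id[unfolded id_def])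
  then show "elliptic_curve E \<Longrightarrow> on_curve E P \<Longrightarrow> (E, P) \<in> closed_point E P"
    unfolding closed_point_iff
    by (intro conjI exI[of _ "\<lambda>x. x"]) (auto simp: weierstrass.map_ident ell_point.map_ident ell_iso_id)
qed

text \<open>If \<open>f\<close> maps the conjugate of \<open>E\<close> by \<open>\<sigma>\<close> to
  \<open>E'\<close>, then its inverse, conjugated by the inverse of \<open>\<sigma>\<close>, is an
  isomorphism from a conjugate of \<open>E'\<close> to \<open>E\<close>.\<close>

lemma closed_point_sym:
  assumes "(E', P') \<in> closed_point E P" "elliptic_curve E" "on_curve E P"
  shows "(E, P) \<in> closed_point E' P'"
proof -
  obtain \<sigma> f where *: "field_aut \<sigma>" "f \<in> ell_iso (map_weierstrass \<sigma> E) E'" "f (map_ell_point \<sigma> P) = P'"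
    using assms by (auto simp: closed_point_iff)
  obtain g where g: "g \<in> ell_iso E' (map_weierstrass \<sigma> E)"
      "\<And>P. on_curve (map_weierstrass \<sigma> E) P \<Longrightarrow> g (f P) = P"
    using ell_iso_inverse[OF *(2)] by metis
  have \<tau>: "field_aut (inv_into UNIV \<sigma>)" by (rule field_aut_inv[OF *(1)])
  obtain h where h: "h \<in> ell_iso (map_weierstrass (inv_into UNIV \<sigma>) E')
        (map_weierstrass (inv_into UNIV \<sigma>) (map_weierstrass \<sigma> E))"
      "\<And>P. h (map_ell_point (inv_into UNIV \<sigma>) P) = map_ell_point (inv_into UNIV \<sigma>) (g P)"
    using ell_iso_conj[OF \<tau> g(1)] by metis
  have "h (map_ell_point (inv_into UNIV \<sigma>) P') = P"
    using g(2) assms(3) * by (auto simp: h(2) on_curve_map)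
  then show ?thesis unfolding closed_point_iff using h(1) \<tau> assms * by auto
qed

text \<open>The first isomorphism has to be conjugated by \<open>\<tau>\<close> before it can be
  composed with the second.\<close>

lemma closed_point_trans:
  assumes "(E', P') \<in> closed_point E P" "(E'', P'') \<in> closed_point E' P'"
  shows "(E'', P'') \<in> closed_point E P"
proof -
  obtain \<sigma> f where f: "field_aut \<sigma>" "f \<in> ell_iso (map_weierstrass \<sigma> E) E'" "f (map_ell_point \<sigma> P) = P'"
    using assms(1) by (auto simp: closed_point_iff)
  obtain \<tau> g where g: "field_aut \<tau>" "g \<in> ell_iso (map_weierstrass \<tau> E') E''" "g (map_ell_point \<tau> P') = P''"
    using assms(2) by (auto simp: closed_point_iff)
  obtain h where h: "h \<in> ell_iso (map_weierstrass \<tau> (map_weierstrass \<sigma> E)) (map_weierstrass \<tau> E')"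
      "\<And>P. h (map_ell_point \<tau> P) = map_ell_point \<tau> (f P)"
    using ell_iso_conj[OF g(1) f(2)] by metis
  have "(\<lambda>P. g (h P)) \<in> ell_iso (map_weierstrass (\<tau> \<circ> \<sigma>) E) E''"
    using ell_iso_compose[OF h(1) g(2)] by (simp add: weierstrass.map_comp)
  moreover have "g (h (map_ell_point (\<tau> \<circ> \<sigma>) P)) = P''"
    using h(2)[of "map_ell_point \<sigma> P"] f(3) g(3) by (simp add: ell_point.map_comp)
  ultimately show ?thesis
    using assms(2) field_aut_comp[OF f(1) g(1)] unfolding closed_point_iff by blast
qed

lemma closed_point_eq:
  assumes "(E', P') \<in> closed_point E P" "elliptic_curve E" "on_curve E P"
  shows "closed_point E' P' = closed_point E P"
proof (intro equalityI subrelI)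
  show "(F, Q) \<in> closed_point E P" if "(F, Q) \<in> closed_point E' P'" for F Q
    by (rule closed_point_trans[OF assms(1) that])
  show "(F, Q) \<in> closed_point E' P'" if "(F, Q) \<in> closed_point E P" for F Q
    by (rule closed_point_trans[OF closed_point_sym[OF assms] that])
qed

lemma ell_iso_hom: "f \<in> ell_iso E E' \<Longrightarrow> f \<in> hom (curve_group E) (curve_group E')"
  by (auto simp: ell_iso_def ell_hom_def)

lemma ell_iso_eq_Infinity_iff:
  assumes "f \<in> ell_iso E E'" "on_curve E P"
  shows "f P = Infinity \<longleftrightarrow> P = Infinity"
proof -
  obtain g where g: "g \<in> ell_iso E' E" "\<And>P. on_curve E P \<Longrightarrow> g (f P) = P"
    using ell_iso_inverse[OF assms(1)] by metis
  show ?thesis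
  proof
    assume "f P = Infinity"
    then show "P = Infinity" using g(2)[OF assms(2)] curve_hom_Infinity[OF ell_iso_hom[OF g(1)]] by simp
  qed (simp add: curve_hom_Infinity[OF ell_iso_hom[OF assms(1)]])
qed

lemma closed_point_pow:
  assumes "(E', P') \<in> closed_point E P" "on_curve E P"
  shows "(E', P' [^]\<^bsub>curve_group E'\<^esub> n) \<in> closed_point E (P [^]\<^bsub>curve_group E\<^esub> (n::nat))"
proof -
  obtain \<sigma> f where f: "elliptic_curve E'" "on_curve E' P'" "field_aut \<sigma>"
      "f \<in> ell_iso (map_weierstrass \<sigma> E) E'" "f (map_ell_point \<sigma> P) = P'"
    using assms(1) by (auto simp: closed_point_iff)
  have "f (map_ell_point \<sigma> (P [^]\<^bsub>curve_group E\<^esub> n)) = P' [^]\<^bsub>curve_group E'\<^esub> n"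
    using curve_hom_pow[OF ell_iso_hom[OF f(4)], of "map_ell_point \<sigma> P" n] assms(2) f
    by (simp add: curve_pow_map on_curve_map)
  then show ?thesis using f curve_pow_closed unfolding closed_point_iff by blast
qed

lemma closed_point_Infinity_iff:
  assumes "(E', P') \<in> closed_point E P" "on_curve E P"
  shows "P' = Infinity \<longleftrightarrow> P = Infinity"
proof -
  obtain \<sigma> f where f: "field_aut \<sigma>" "f \<in> ell_iso (map_weierstrass \<sigma> E) E'" "f (map_ell_point \<sigma> P) = P'"
    using assms(1) by (auto simp: closed_point_iff)
  have "f (map_ell_point \<sigma> P) = Infinity \<longleftrightarrow> map_ell_point \<sigma> P = Infinity"
    using ell_iso_eq_Infinity_iff[OF f(2)] assms(2) f(1) by (simp add: on_curve_map)
  then show ?thesis using f(3) by (cases P) auto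
qed

text \<open>Exact order only records which multiples are trivial, and forming multiples commutes
  with passing to another pair of the closed point.\<close>

lemma has_exact_order_closed_point:
  assumes "(E', P') \<in> closed_point E P" "has_exact_order E P n"
  shows "has_exact_order E' P' n"
proof -
  have P: "on_curve E P" using assms(2) by (simp add: has_exact_order_def)
  have "P' [^]\<^bsub>curve_group E'\<^esub> k = Infinity \<longleftrightarrow> P [^]\<^bsub>curve_group E\<^esub> k = Infinity" for k :: nat
    by (rule closed_point_Infinity_iff[OF closed_point_pow[OF assms(1) P] curve_pow_closed[OF P]])
  then show ?thesis using assms by (auto simp: has_exact_order_def closed_point_iff)
qed

text \<open>Well-definedness of the map on closed points: the union runs over a constant family,
  indexed by a set containing \<open>(E, P)\<close>.\<close>

lemma X1_map_closed_point:
  assumes "elliptic_curve E" "on_curve E P"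
  shows "X1_map n (closed_point E P) = closed_point E (P [^]\<^bsub>curve_group E\<^esub> n)"
proof -
  have "closed_point E' (P' [^]\<^bsub>curve_group E'\<^esub> n) = closed_point E (P [^]\<^bsub>curve_group E\<^esub> n)"
    if "(E', P') \<in> closed_point E P" for E' P'
    by (rule closed_point_eq[OF closed_point_pow[OF that assms(2)] assms(1) curve_pow_closed[OF assms(2)]])
  then show ?thesis
    unfolding X1_map_def by (intro UN_constant_eq[OF closed_point_refl[OF assms]]) auto
qed

subsection \<open>The $j$-invariant is an isomorphism invariant\<close>

text \<open>Completing the square: the square of \<open>eta\<close> is the cubic
  \<open>4 x^3 + b2 x^2 + 2 b4 x + b6\<close>, defined next as \<open>two_torsion_poly\<close>.
  Negation of points changes the sign of \<open>eta\<close>, so the zeros of \<open>eta\<close> on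
  the curve are the points of order 2.\<close>

fun eta :: "'a::field weierstrass \<Rightarrow> 'a \<Rightarrow> 'a \<Rightarrow> 'a" where
  "eta (Weierstrass a1 a2 a3 a4 a6) x y = 2 * y + a1 * x + a3"

fun two_torsion_poly :: "'a::field weierstrass \<Rightarrow> 'a poly" where
  "two_torsion_poly (Weierstrass a1 a2 a3 a4 a6) =
    [:a3^2 + 4 * a6, 2 * (2 * a4 + a1 * a3), a1^2 + 4 * a2, 4:]"

lemma on_curve_iff_eta:
  fixes E :: "'a::field_char_0 weierstrass"
  shows "on_curve E (Affine x y) \<longleftrightarrow> eta E x y ^ 2 = poly (two_torsion_poly E) x"
proof (cases E)
  case (Weierstrass a1 a2 a3 a4 a6)
  have "eta E x y ^ 2 - poly (two_torsion_poly E) x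
    = 4 * (y^2 + a1 * x * y + a3 * y - (x^3 + a2 * x^2 + a4 * x + a6))"
    unfolding Weierstrass by (simp add: algebra_simps power2_eq_square power3_eq_cube)
  then have "eta E x y ^ 2 = poly (two_torsion_poly E) x \<longleftrightarrow>
      y^2 + a1 * x * y + a3 * y - (x^3 + a2 * x^2 + a4 * x + a6) = 0"
    by (metis mult_eq_0_iff right_minus_eq zero_neq_numeral)
  then show ?thesis unfolding Weierstrass by simp
qed

lemma curve_neg_Affine: "\<exists>y'. curve_neg E (Affine x y) = Affine x y' \<and> eta E x y' = - eta E x y"
  by (cases E) simp

lemma curve_neg_eq_self_iff:
  fixes E :: "'a::field_char_0 weierstrass"
  shows "curve_neg E (Affine x y) = Affine x y \<longleftrightarrow> eta E x y = 0"
proof (cases E)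
  case (Weierstrass a1 a2 a3 a4 a6)
  have "- y - a1 * x - a3 = y \<longleftrightarrow> y - (- y - a1 * x - a3) = 0" by (metis right_minus_eq)
  also have "y - (- y - a1 * x - a3) = eta E x y" by (simp add: Weierstrass)
  finally show ?thesis by (simp add: Weierstrass)
qed

lemma on_curve_same_x:
  fixes E :: "'a::field_char_0 weierstrass"
  assumes "on_curve E (Affine x y)" "on_curve E (Affine x y')"
  shows "Affine x y' = Affine x y \<or> Affine x y' = curve_neg E (Affine x y)"
proof (cases E)
  case (Weierstrass a1 a2 a3 a4 a6)
  have "eta E x y' ^ 2 = eta E x y ^ 2" using assms by (simp add: on_curve_iff_eta)
  then consider "eta E x y' = eta E x y" | "eta E x y' = - eta E x y"
    by (auto simp: power2_eq_iff)
  then show ?thesis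
  proof cases
    case 1
    then show ?thesis by (simp add: Weierstrass)
  next
    case 2
    moreover have "2 * (y' - (- y - a1 * x - a3)) = eta E x y' + eta E x y"
      by (simp add: Weierstrass algebra_simps)
    ultimately have "2 * (y' - (- y - a1 * x - a3)) = 0" by (simp only: left_minus)
    then have "y' - (- y - a1 * x - a3) = 0" by (simp only: mult_eq_0_iff numeral_neq_zero simp_thms)
    then have "y' = - y - a1 * x - a3" by (simp only: right_minus_eq)
    then show ?thesis by (simp add: Weierstrass)
  qed
qed

section \<open>Points above a given \<open>x\<close> and polynomial functions on the affine
  curve\<close>

lemma ex_on_curve:
  fixes E :: "'a::{alg_closed_field, field_char_0} weierstrass"
  shows "\<exists>y. on_curve E (Affine x y)"
proof -
  obtain e where e: "e ^ 2 = poly (two_torsion_poly E) x"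
    using nth_root_exists[of 2] by force
  obtain a1 a2 a3 a4 a6 where E: "E = Weierstrass a1 a2 a3 a4 a6" by (cases E)
  have "2 * (z / 2) = z" for z :: 'a by simp
  then have "eta E x ((e - a1 * x - a3) / 2) = e" unfolding E eta.simps by (simp only:) simp
  then show ?thesis using e on_curve_iff_eta by metis
qed

text \<open>The normal form uses the basis \<open>1\<close>, \<open>eta\<close> of the coordinate
  ring over the polynomials in \<open>x\<close>; its two summands are the even and odd parts under
  negation.\<close>

definition regular :: "'a::field weierstrass \<Rightarrow> ('a \<Rightarrow> 'a \<Rightarrow> 'a) \<Rightarrow> bool" where
  "regular E h \<longleftrightarrow> (\<exists>A B. \<forall>x y. on_curve E (Affine x y) \<longrightarrow> h x y = poly A x + poly B x * eta E x y)"

lemma regularI: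
  "(\<And>x y. on_curve E (Affine x y) \<Longrightarrow> h x y = poly A x + poly B x * eta E x y) \<Longrightarrow> regular E h"
  by (auto simp: regular_def)

lemma regular_const: "regular E (\<lambda>x y. k)"
  by (rule regularI[of _ _ "[:k:]" 0]) simp

lemma regular_x: "regular E (\<lambda>x y. x)"
  by (rule regularI[of _ _ "[:0, 1:]" 0]) simp

lemma regular_y: "regular E (\<lambda>x y. y :: 'a::field_char_0)"
proof (cases E)
  case (Weierstrass a1 a2 a3 a4 a6)
  show ?thesis
    by (rule regularI[of _ _ "[:- a3 / 2, - a1 / 2:]" "[:1 / 2:]"]) (simp add: Weierstrass field_simps)
qed

lemma regular_add:
  assumes "regular E h" "regular E k"
  shows "regular E (\<lambda>x y. h x y + k x y)"
proof -
  obtain A B C D where "\<And>x y. on_curve E (Affine x y) \<Longrightarrow> h x y = poly A x + poly B x * eta E x y"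
    "\<And>x y. on_curve E (Affine x y) \<Longrightarrow> k x y = poly C x + poly D x * eta E x y"
    using assms unfolding regular_def by metis
  then show ?thesis by (intro regularI[of _ _ "A + C" "B + D"]) (simp add: algebra_simps)
qed

lemma regular_mult:
  fixes E :: "'a::field_char_0 weierstrass"
  assumes "regular E h" "regular E k"
  shows "regular E (\<lambda>x y. h x y * k x y)"
proof -
  obtain A B C D where h: "\<And>x y. on_curve E (Affine x y) \<Longrightarrow> h x y = poly A x + poly B x * eta E x y"
    and k: "\<And>x y. on_curve E (Affine x y) \<Longrightarrow> k x y = poly C x + poly D x * eta E x y"
    using assms unfolding regular_def by metis
  \<comment> \<open>The product of the two \<open>eta\<close> terms becomes a polynomial in
    \<open>x\<close>, because on the curve the square of \<open>eta\<close> is the cubic.\<close>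
  show ?thesis
  proof (rule regularI[of _ _ "A * C + B * D * two_torsion_poly E" "A * D + B * C"])
    fix x y assume xy: "on_curve E (Affine x y)"
    then have "poly (two_torsion_poly E) x = eta E x y * eta E x y"
      by (simp add: on_curve_iff_eta power2_eq_square)
    then show "h x y * k x y = poly (A * C + B * D * two_torsion_poly E) x + poly (A * D + B * C) x * eta E x y"
      using h[OF xy] k[OF xy] by (simp add: algebra_simps)
  qed
qed

lemma regular_power: "regular E h \<Longrightarrow> regular E (\<lambda>x y. h x y ^ n :: 'a::field_char_0)"
  by (induction n) (auto intro: regular_const regular_mult)

lemma regular_sum:
  "(\<And>i. i \<in> I \<Longrightarrow> regular E (h i)) \<Longrightarrow> regular E (\<lambda>x y. \<Sum>i\<in>I. h i x y)"
  by (induction I rule: infinite_finite_induct) (auto intro: regular_const regular_add)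

lemma regular_form: "regular E (\<lambda>x y. form n c (x, y, 1 :: 'a::field_char_0))"
  unfolding form_apply
  by (intro regular_sum regular_mult regular_power regular_const regular_x regular_y)

text \<open>The denominators of \<open>u\<close> form an ideal \<open>I\<close> of polynomials. A
  nonzero element of least degree divides all others, so a root of it would be a common zero of all
  denominators, which the hypothesis excludes. Over an algebraically closed field it is therefore
  constant.\<close>

lemma poly_of_locally_rational:
  fixes u :: "'a::alg_closed_field \<Rightarrow> 'a"
  assumes "\<And>x0. \<exists>a b. poly b x0 \<noteq> 0 \<and> (\<forall>x. poly a x = u x * poly b x)"
  shows "\<exists>p. \<forall>x. u x = poly p x"
proof -
  define I where "I = {b. \<exists>a. \<forall>x. poly a x = u x * poly b x}"
  have diff: "b' - q * b \<in> I" if "b \<in> I" "b' \<in> I" for b b' q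
  proof -
    obtain a a' where "\<And>x. poly a x = u x * poly b x" "\<And>x. poly a' x = u x * poly b' x"
      using \<open>b \<in> I\<close> \<open>b' \<in> I\<close> by (auto simp: I_def)
    then have "\<forall>x. poly (a' - q * a) x = u x * poly (b' - q * b) x" by (simp add: algebra_simps)
    then show ?thesis unfolding I_def by blast
  qed
  have ex: "\<exists>b\<in>I. poly b x0 \<noteq> 0" for x0 using assms[of x0] by (auto simp: I_def)
  then have "\<exists>b. b \<in> I \<and> b \<noteq> 0" by (metis poly_0)
  then obtain b where b: "b \<in> I" "b \<noteq> 0" and min: "\<And>b'. b' \<in> I \<Longrightarrow> b' \<noteq> 0 \<Longrightarrow> degree b \<le> degree b'"
    using ex_has_least_nat[of "\<lambda>b. b \<in> I \<and> b \<noteq> 0" _ degree] by blast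
  have "degree b = 0"
  proof (rule ccontr)
    assume "degree b \<noteq> 0"
    then obtain r where r: "poly b r = 0" using alg_closed_imp_poly_has_root[of b] by auto
    obtain b' where b': "b' \<in> I" "poly b' r \<noteq> 0" using ex by blast
    have "b' mod b \<in> I" using diff[OF b(1) b'(1), of "b' div b"] by (simp add: minus_div_mult_eq_mod)
    then have "b' mod b = 0" using degree_mod_less[OF b(2), of b'] min[of "b' mod b"] by (meson leD)
    then have "b dvd b'" by auto
    then show False using r b'(2) by (metis dvdE mult_eq_0_iff poly_mult)
  qed
  then obtain k where k: "b = [:k:]" using degree_eq_zeroE by blast
  obtain a where a: "\<And>x. poly a x = u x * poly b x" using b(1) by (auto simp: I_def)
  have "\<forall>x. u x = poly (smult (1 / k) a) x" using b(2) by (simp add: a k)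
  then show ?thesis by blast
qed

text \<open>Two affine points with the same \<open>x\<close> are equal or negatives of each other,
  and \<open>f\<close> commutes with negation, which keeps the first coordinate. Injectivity of
  \<open>f\<close> keeps affine points away from \<open>Infinity\<close>.\<close>

lemma ell_iso_x_coord:
  fixes E E' :: "'a::{alg_closed_field, field_char_0} weierstrass"
  assumes f: "f \<in> ell_iso E E'"
  shows "\<exists>u. \<forall>x y. on_curve E (Affine x y) \<longrightarrow> (\<exists>y'. f (Affine x y) = Affine (u x) y')"
proof -
  have "\<exists>x'. \<forall>y. on_curve E (Affine x y) \<longrightarrow> (\<exists>y'. f (Affine x y) = Affine x' y')" for x
  proof -
    obtain y0 where y0: "on_curve E (Affine x y0)" using ex_on_curve by blast
    have "f (Affine x y0) \<noteq> Infinity" using ell_iso_eq_Infinity_iff[OF f y0] by simp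
    then obtain x' y' where *: "f (Affine x y0) = Affine x' y'" by (cases "f (Affine x y0)") auto
    have "\<exists>y'. f (Affine x y) = Affine x' y'" if y: "on_curve E (Affine x y)" for y
      using on_curve_same_x[OF y0 y]
    proof
      assume "Affine x y = curve_neg E (Affine x y0)"
      then have "f (Affine x y) = curve_neg E' (Affine x' y')"
        using curve_hom_neg[OF ell_iso_hom[OF f] y0] * by simp
      then show ?thesis using curve_neg_Affine by metis
    qed (use * in auto)
    then show ?thesis by blast
  qed
  then show ?thesis by metis
qed

text \<open>
  The first coordinate of \<open>f\<close> is invariant under negation, so a local quotient of polynomials
  representing it can be split into the parts even and odd in \<open>eta\<close>; each is a quotient in \<open>x\<close> alone, and
  one of the two denominators does not vanish at the given point.
\<close>

lemma ell_iso_x_coord_poly: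
  fixes E E' :: "'a::{alg_closed_field, field_char_0} weierstrass"
  assumes f: "f \<in> ell_iso E E'"
    and u: "\<And>x y. on_curve E (Affine x y) \<Longrightarrow> \<exists>y'. f (Affine x y) = Affine (u x) y'"
  shows "\<exists>p. \<forall>x. u x = poly p x"
proof (rule poly_of_locally_rational)
  fix x0
  obtain y0 where y0: "on_curve E (Affine x0 y0)" using ex_on_curve by blast
  have "curve_morphism E E' f" using f by (auto simp: ell_iso_def ell_hom_def)
  then obtain n F where F: "homogeneous_map n F" "F (proj_coords (Affine x0 y0)) \<noteq> (0, 0, 0)"
      and rep: "represents E f F"
    using y0 unfolding curve_morphism_iff by blast
  obtain c d e where cde: "F = (\<lambda>p. (form n c p, form n d p, form n e p))"
    using F(1) unfolding homogeneous_map_form_triple by blast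
  have F_eq: "\<exists>t. F (x, y, 1) = (t * u x, t * y', t) \<and> (t = 0 \<longrightarrow> F (x, y, 1) = (0, 0, 0))"
    if "on_curve E (Affine x y)" "f (Affine x y) = Affine (u x) y'" for x y y'
    using that rep by (fastforce simp: represents_def)
  have ce: "form n c (x, y, 1) = u x * form n e (x, y, 1)" if "on_curve E (Affine x y)" for x y
    using F_eq[OF that] u[OF that] by (auto simp: cde)
  \<comment> \<open>The last coordinate is the common factor \<open>t\<close>; if it were 0, all
    three forms would vanish at the chosen point.\<close>
  have e0: "form n e (x0, y0, 1) \<noteq> 0"
    using F_eq[OF y0] u[OF y0] F(2) by (auto simp: cde)
  obtain A B where AB: "\<And>x y. on_curve E (Affine x y) \<Longrightarrow> form n c (x, y, 1) = poly A x + poly B x * eta E x y"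
    using regular_form[of E n c] unfolding regular_def by blast
  obtain C D where CD: "\<And>x y. on_curve E (Affine x y) \<Longrightarrow> form n e (x, y, 1) = poly C x + poly D x * eta E x y"
    using regular_form[of E n e] unfolding regular_def by blast
  \<comment> \<open>Evaluate at the point and at its negative, where \<open>eta\<close> has the
    opposite sign; then add and subtract.\<close>
  have even_odd: "poly A x = u x * poly C x \<and> poly B x * eta E x y = u x * (poly D x * eta E x y)"
    if xy: "on_curve E (Affine x y)" for x y
  proof -
    obtain y' where y': "curve_neg E (Affine x y) = Affine x y'" "eta E x y' = - eta E x y"
      using curve_neg_Affine by metis
    have xy': "on_curve E (Affine x y')" using xy by (metis on_curve_neg y'(1))
    have 1: "poly A x + poly B x * eta E x y = u x * (poly C x + poly D x * eta E x y)"
      using ce[OF xy] AB[OF xy] CD[OF xy] by simp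
    have 2: "poly A x - poly B x * eta E x y = u x * (poly C x - poly D x * eta E x y)"
      using ce[OF xy'] AB[OF xy'] CD[OF xy'] y'(2) by simp
    have "2 * poly A x = 2 * (u x * poly C x)"
      using arg_cong2[OF 1 2, of "(+)"] by (simp add: algebra_simps)
    moreover have "2 * (poly B x * eta E x y) = 2 * (u x * (poly D x * eta E x y))"
      using arg_cong2[OF 1 2, of "(-)"] by (simp add: algebra_simps)
    ultimately show ?thesis by simp
  qed
  let ?g = "two_torsion_poly E"
  \<comment> \<open>Multiplying the odd identity once more by \<open>eta\<close> replaces
    \<open>eta\<close> by the cubic, so that both identities involve \<open>x\<close> alone.\<close>
  have even: "poly A x = u x * poly C x" and odd: "poly (B * ?g) x = u x * poly (D * ?g) x" for x
  proof -
    obtain y where xy: "on_curve E (Affine x y)" using ex_on_curve by blast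
    then have g: "poly ?g x = eta E x y * eta E x y" by (simp add: on_curve_iff_eta power2_eq_square)
    show "poly A x = u x * poly C x" using even_odd[OF xy] by simp
    show "poly (B * ?g) x = u x * poly (D * ?g) x"
      using arg_cong[OF conjunct2[OF even_odd[OF xy]], of "\<lambda>z. z * eta E x y"] by (simp add: g mult.assoc)
  qed
  show "\<exists>a b. poly b x0 \<noteq> 0 \<and> (\<forall>x. poly a x = u x * poly b x)"
  proof (cases "poly C x0 = 0")
    case False
    then show ?thesis using even by blast
  next
    case True
    then have "poly D x0 \<noteq> 0" "eta E x0 y0 \<noteq> 0" using e0 CD[OF y0] by auto
    then have "poly (D * ?g) x0 \<noteq> 0" using y0 by (simp add: on_curve_iff_eta flip: on_curve_iff_eta)
        (simp flip: y0[unfolded on_curve_iff_eta])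
    then show ?thesis using odd by blast
  qed
qed

text \<open>The actions of \<open>f\<close> and of its inverse on first coordinates are polynomials
  whose composite is the identity, so both have degree 1.\<close>

lemma ell_iso_x_affine:
  fixes E E' :: "'a::{alg_closed_field, field_char_0} weierstrass"
  assumes f: "f \<in> ell_iso E E'"
  obtains \<alpha> \<beta> where "\<alpha> \<noteq> 0"
    "\<And>x y. on_curve E (Affine x y) \<Longrightarrow> \<exists>y'. f (Affine x y) = Affine (\<alpha> * x + \<beta>) y'"
proof -
  obtain g where g: "g \<in> ell_iso E' E" "\<And>P. on_curve E P \<Longrightarrow> g (f P) = P"
    using ell_iso_inverse[OF f] by metis
  obtain u where u: "\<And>x y. on_curve E (Affine x y) \<Longrightarrow> \<exists>y'. f (Affine x y) = Affine (u x) y'"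
    using ell_iso_x_coord[OF f] by blast
  obtain w where w: "\<And>x y. on_curve E' (Affine x y) \<Longrightarrow> \<exists>y'. g (Affine x y) = Affine (w x) y'"
    using ell_iso_x_coord[OF g(1)] by blast
  obtain p where p: "\<And>x. u x = poly p x" using ell_iso_x_coord_poly[OF f u] by blast
  obtain q where q: "\<And>x. w x = poly q x" using ell_iso_x_coord_poly[OF g(1) w] by blast
  have "poly (pcompose q p) x = poly [:0, 1:] x" for x
  proof -
    obtain y where xy: "on_curve E (Affine x y)" using ex_on_curve by blast
    obtain y' where y': "f (Affine x y) = Affine (u x) y'" using u[OF xy] by blast
    have "on_curve E' (Affine (u x) y')"
      using xy ell_iso_hom[OF f] y' unfolding hom_def Pi_iff by (metis (no_types, lifting) curve_group_simps(1) mem_Collect_eq)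
    then obtain y'' where "g (Affine (u x) y') = Affine (w (u x)) y''" using w by blast
    then have "w (u x) = x" using g(2)[OF xy] y' by simp
    then show ?thesis by (simp add: poly_pcompose p q)
  qed
  then have "pcompose q p = [:0, 1:]" by (auto simp flip: poly_eq_poly_eq_iff)
  then have "degree q * degree p = 1" using degree_pcompose[of q p] by simp
  then have "degree p = 1" by simp
  then obtain \<alpha> \<beta> where ab: "p = [:\<beta>, \<alpha>:]" "\<alpha> \<noteq> 0" by (metis degree1_coeffs)
  have "\<And>x y. on_curve E (Affine x y) \<Longrightarrow> \<exists>y'. f (Affine x y) = Affine (\<alpha> * x + \<beta>) y'"
    using u p ab(1) by (simp add: add.commute mult.commute)
  then show ?thesis using that ab(2) by blast
qed

text \<open>A root of the cubic is the \<open>x\<close> of a point equal to its own negative, and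
  homomorphisms preserve that property.\<close>

lemma ell_iso_two_torsion_roots:
  fixes E E' :: "'a::{alg_closed_field, field_char_0} weierstrass"
  assumes f: "f \<in> ell_iso E E'"
    and u: "\<And>x y. on_curve E (Affine x y) \<Longrightarrow> \<exists>y'. f (Affine x y) = Affine (\<alpha> * x + \<beta>) y'"
    and root: "poly (two_torsion_poly E) x = 0"
  shows "poly (two_torsion_poly E') (\<alpha> * x + \<beta>) = 0"
proof -
  obtain y where xy: "on_curve E (Affine x y)" using ex_on_curve by blast
  obtain y' where y': "f (Affine x y) = Affine (\<alpha> * x + \<beta>) y'" using u[OF xy] by blast
  have "on_curve E' (Affine (\<alpha> * x + \<beta>) y')"
    using xy ell_iso_hom[OF f] y' unfolding hom_def Pi_iff by (metis (no_types, lifting) curve_group_simps(1) mem_Collect_eq)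
  moreover have "eta E x y = 0" using xy root by (simp add: on_curve_iff_eta)
  then have "curve_neg E' (Affine (\<alpha> * x + \<beta>) y') = Affine (\<alpha> * x + \<beta>) y'"
    using curve_hom_neg[OF ell_iso_hom[OF f] xy] y' curve_neg_eq_self_iff by metis
  then have "eta E' (\<alpha> * x + \<beta>) y' = 0" by (simp only: curve_neg_eq_self_iff)
  ultimately show ?thesis by (simp add: on_curve_iff_eta)
qed

section \<open>The discriminant and the \<open>j\<close>-invariant through the roots of the
  cubic\<close>

lemma two_torsion_poly_factorization:
  fixes E :: "'a::{alg_closed_field, field_char_0} weierstrass"
  obtains r1 r2 r3 where "two_torsion_poly E = smult 4 (\<Prod>r\<in>#{#r1, r2, r3#}. [:- r, 1:])"
proof (cases E)
  case (Weierstrass a1 a2 a3 a4 a6)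
  then have deg: "degree (two_torsion_poly E) = 3" "lead_coeff (two_torsion_poly E) = 4" by simp_all
  then have "two_torsion_poly E \<noteq> 0" by auto
  then obtain A where A: "size A = 3" "two_torsion_poly E = smult 4 (\<Prod>r\<in>#A. [:- r, 1:])"
    using alg_closed_imp_factorization[of "two_torsion_poly E"] deg by metis
  obtain r1 A1 where A1: "A = add_mset r1 A1" using A(1) size_eq_Suc_imp_eq_union[of A 2] by auto
  obtain r2 A2 where A2: "A1 = add_mset r2 A2" using A(1) A1 size_eq_Suc_imp_eq_union[of A1 1] by auto
  obtain r3 A3 where A3: "A2 = add_mset r3 A3" using A(1) A1 A2 size_eq_Suc_imp_eq_union[of A2 0] by auto
  have "A = {#r1, r2, r3#}" using A(1) by (simp add: A1 A2 A3)
  then show ?thesis using that A(2) by blast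
qed

text \<open>The coefficients of the cubic give \<open>b2\<close>, \<open>b4\<close>,
  \<open>b6\<close> as symmetric functions of the roots, and \<open>b8\<close> follows from
  \<open>4 b8 = b2 b6 - b4^2\<close>. In this form the effect of an affine change of
  \<open>x\<close> can be computed.\<close>

lemma invariants_of_roots:
  fixes E :: "'a::field_char_0 weierstrass"
  assumes "two_torsion_poly E = smult 4 (\<Prod>r\<in>#{#r1, r2, r3#}. [:- r, 1:])"
  shows "discriminant E = 16 * ((r1 - r2) * (r1 - r3) * (r2 - r3))^2" (is ?disc)
    and "j_invariant E = (16 * ((r1 + r2 + r3)^2 - 3 * (r1 * r2 + r1 * r3 + r2 * r3)))^3
      / (16 * ((r1 - r2) * (r1 - r3) * (r2 - r3))^2)" (is ?j)
proof -
  obtain a1 a2 a3 a4 a6 where E: "E = Weierstrass a1 a2 a3 a4 a6" by (cases E)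
  define b2 where "b2 = a1^2 + 4 * a2"
  define b4 where "b4 = 2 * a4 + a1 * a3"
  define b6 where "b6 = a3^2 + 4 * a6"
  define b8 where "b8 = a1^2 * a6 + 4 * a2 * a6 - a1 * a3 * a4 + a2 * a3^2 - a4^2"
  have "[:b6, 2 * b4, b2, 4:] = smult 4 (\<Prod>r\<in>#{#r1, r2, r3#}. [:- r, 1:])"
    using assms by (simp add: E b2_def b4_def b6_def)
  then have b: "b2 = - 4 * (r1 + r2 + r3)" "2 * b4 = 2 * (2 * (r1 * r2 + r1 * r3 + r2 * r3))"
      "b6 = - 4 * (r1 * r2 * r3)"
    by (simp_all add: algebra_simps)
  then have b4: "b4 = 2 * (r1 * r2 + r1 * r3 + r2 * r3)" by (simp only: mult_cancel_left) simp
  have "4 * b8 = b2 * b6 - b4^2"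
    by (simp add: b2_def b4_def b6_def b8_def algebra_simps power2_eq_square)
  then have b8: "b8 = (b2 * b6 - b4^2) / 4" by (simp add: eq_divide_eq mult.commute)
  have "4 * discriminant E = - (b2^2 * (b2 * b6 - b4^2)) - 32 * b4^3 - 108 * b6^2 + 36 * b2 * b4 * b6"
    by (simp add: E Let_def b8 flip: b2_def b4_def b6_def b8_def)
  also have "\<dots> = 4 * (16 * ((r1 - r2) * (r1 - r3) * (r2 - r3))^2)"
    unfolding b(1,3) b4 by (simp add: algebra_simps power2_eq_square power3_eq_cube)
  finally show disc: ?disc by simp
  have "b2^2 - 24 * b4 = 16 * ((r1 + r2 + r3)^2 - 3 * (r1 * r2 + r1 * r3 + r2 * r3))"
    unfolding b(1,3) b4 by (simp add: algebra_simps power2_eq_square)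
  then show ?j using disc by (simp add: E Let_def b2_def b4_def)
qed

text \<open>An affine map with leading coefficient \<open>\<alpha>\<close> carries the roots for
  \<open>E\<close> to those for \<open>E'\<close>. This multiplies the numerator's base
  \<open>c4\<close> by \<open>\<alpha>^2\<close> and the discriminant by \<open>\<alpha>^6\<close>,
  which cancels in \<open>c4^3\<close> over the discriminant.\<close>

lemma j_invariant_ell_iso:
  fixes E E' :: "'a::{alg_closed_field, field_char_0} weierstrass"
  assumes f: "f \<in> ell_iso E E'" and "elliptic_curve E" "elliptic_curve E'"
  shows "j_invariant E = j_invariant E'"
proof -
  obtain \<alpha> \<beta> where \<alpha>: "\<alpha> \<noteq> 0"
    and u: "\<And>x y. on_curve E (Affine x y) \<Longrightarrow> \<exists>y'. f (Affine x y) = Affine (\<alpha> * x + \<beta>) y'"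
    using ell_iso_x_affine[OF f] by metis
  obtain r1 r2 r3 where r: "two_torsion_poly E = smult 4 (\<Prod>r\<in>#{#r1, r2, r3#}. [:- r, 1:])"
    by (rule two_torsion_poly_factorization)
  obtain s1 s2 s3 where s: "two_torsion_poly E' = smult 4 (\<Prod>r\<in>#{#s1, s2, s3#}. [:- r, 1:])"
    by (rule two_torsion_poly_factorization)
  have r_ne: "r1 \<noteq> r2" "r1 \<noteq> r3" "r2 \<noteq> r3"
    using assms(2) invariants_of_roots(1)[OF r] by (auto simp: elliptic_curve_def)
  have eval: "poly (smult 4 (\<Prod>r\<in>#{#q1, q2, q3#}. [:- r, 1:])) t = 4 * ((t - q1) * (t - q2) * (t - q3))"
    for q1 q2 q3 t :: 'a by (simp add: algebra_simps)
  have "\<alpha> * t + \<beta> \<in> {s1, s2, s3}" if "t \<in> {r1, r2, r3}" for t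
  proof -
    have "poly (two_torsion_poly E) t = 0" using that unfolding r eval by auto
    then have "poly (two_torsion_poly E') (\<alpha> * t + \<beta>) = 0" using ell_iso_two_torsion_roots[OF f u] by blast
    then show ?thesis unfolding s eval by auto
  qed
  then have in_s: "\<alpha> * r1 + \<beta> \<in> {s1, s2, s3}" "\<alpha> * r2 + \<beta> \<in> {s1, s2, s3}" "\<alpha> * r3 + \<beta> \<in> {s1, s2, s3}"
    by blast+
  \<comment> \<open>Three distinct values among \<open>s1\<close>, \<open>s2\<close>,
    \<open>s3\<close> exhaust them, so the two multisets of roots agree.\<close>
  have "\<alpha> * r1 + \<beta> \<noteq> \<alpha> * r2 + \<beta>" "\<alpha> * r1 + \<beta> \<noteq> \<alpha> * r3 + \<beta>" "\<alpha> * r2 + \<beta> \<noteq> \<alpha> * r3 + \<beta>"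
    using r_ne \<alpha> by auto
  with in_s have "{#s1, s2, s3#} = {#\<alpha> * r1 + \<beta>, \<alpha> * r2 + \<beta>, \<alpha> * r3 + \<beta>#}"
    by (auto simp del: add_right_cancel)
  then have r': "two_torsion_poly E' = smult 4 (\<Prod>r\<in>#{#\<alpha> * r1 + \<beta>, \<alpha> * r2 + \<beta>, \<alpha> * r3 + \<beta>#}. [:- r, 1:])"
    using s by simp
  let ?D = "16 * ((r1 - r2) * (r1 - r3) * (r2 - r3))^2"
  let ?c = "16 * ((r1 + r2 + r3)^2 - 3 * (r1 * r2 + r1 * r3 + r2 * r3))"
  let ?s1 = "\<alpha> * r1 + \<beta>" and ?s2 = "\<alpha> * r2 + \<beta>" and ?s3 = "\<alpha> * r3 + \<beta>"
  have "16 * ((?s1 - ?s2) * (?s1 - ?s3) * (?s2 - ?s3))^2 = \<alpha>^6 * ?D"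
  proof -
    have "(?s1 - ?s2) * (?s1 - ?s3) * (?s2 - ?s3) = \<alpha>^3 * ((r1 - r2) * (r1 - r3) * (r2 - r3))"
      by (simp add: algebra_simps power3_eq_cube)
    then show ?thesis by (simp add: power_mult_distrib flip: power_mult)
  qed
  moreover have "16 * ((?s1 + ?s2 + ?s3)^2 - 3 * (?s1 * ?s2 + ?s1 * ?s3 + ?s2 * ?s3)) = \<alpha>^2 * ?c"
    by (simp add: algebra_simps power2_eq_square)
  ultimately have "j_invariant E' = (\<alpha>^2 * ?c)^3 / (\<alpha>^6 * ?D)"
    unfolding invariants_of_roots(2)[OF r'] by simp
  also have "\<dots> = ?c^3 / ?D" using \<alpha> by (simp add: power_mult_distrib flip: power_mult)
  also have "\<dots> = j_invariant E" by (rule invariants_of_roots(2)[OF r, symmetric])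
  finally show ?thesis by simp
qed

subsection \<open>Coordinates on the torsion\<close>

text \<open>Arbitrary integers are accepted as coordinates and reduced here, since
  \<open>\<phi> n\<close> is only meaningful on the representatives below \<open>l^n\<close>. Group
  operations and matrices can then be handled by plain integer arithmetic.\<close>

definition tate_point ::
    "nat \<Rightarrow> (nat \<Rightarrow> int \<times> int \<Rightarrow> qbar ell_point) \<Rightarrow> nat \<Rightarrow> int \<Rightarrow> int \<Rightarrow> qbar ell_point" where
  "tate_point l \<phi> n a b = \<phi> n (a mod int (l^n), b mod int (l^n))"

context
  fixes E :: "qbar weierstrass" and l :: nat and \<phi> :: "nat \<Rightarrow> int \<times> int \<Rightarrow> qbar ell_point"
  assumes l: "l > 0" and basis: "tate_basis E l \<phi>"
begin

lemma tate_basis_bij: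
  "bij_betw (\<phi> n) ({0..<int (l^n)} \<times> {0..<int (l^n)})
    {P. on_curve E P \<and> P [^]\<^bsub>curve_group E\<^esub> (l^n) = Infinity}"
proof -
  have "\<phi> n \<in> iso (zmod2 (l^n)) (torsion_group E (l^n))" using basis by (simp add: tate_basis_def)
  then show ?thesis
    using l by (simp add: iso_def torsion_group_def DirProd_def carrier_integer_mod_group)
qed

lemma tate_point_torsion:
  "on_curve E (tate_point l \<phi> n a b) \<and> tate_point l \<phi> n a b [^]\<^bsub>curve_group E\<^esub> (l^n) = Infinity"
proof -
  have "(a mod int (l^n), b mod int (l^n)) \<in> {0..<int (l^n)} \<times> {0..<int (l^n)}" using l by simp
  from bij_betw_apply[OF tate_basis_bij this] show ?thesis by (simp add: tate_point_def)
qed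

lemmas on_curve_tate_point = tate_point_torsion[THEN conjunct1]

lemma tate_point_eq_iff:
  "tate_point l \<phi> n a b = tate_point l \<phi> n a' b' \<longleftrightarrow>
    int (l^n) dvd a - a' \<and> int (l^n) dvd b - b'"
proof -
  have "(a mod int (l^n), b mod int (l^n)) \<in> {0..<int (l^n)} \<times> {0..<int (l^n)}" for a b using l by simp
  then have "tate_point l \<phi> n a b = tate_point l \<phi> n a' b' \<longleftrightarrow>
      (a mod int (l^n), b mod int (l^n)) = (a' mod int (l^n), b' mod int (l^n))"
    unfolding tate_point_def
    by (intro inj_on_eq_iff[OF bij_betw_imp_inj_on[OF tate_basis_bij]])
  then show ?thesis by (simp add: mod_eq_dvd_iff)
qed

text \<open>The second conclusion ties the coordinates to the \<open>inv_into\<close> expression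
  from which \<open>rho_mod\<close> is built.\<close>

lemma tate_point_surj:
  assumes "on_curve E P" "P [^]\<^bsub>curve_group E\<^esub> (l^n) = Infinity"
  obtains a b where "P = tate_point l \<phi> n a b" "inv_into (carrier (zmod2 (l^n))) (\<phi> n) P = (a, b)"
proof -
  have carr: "carrier (zmod2 (l^n)) = {0..<int (l^n)} \<times> {0..<int (l^n)}"
    using l by (simp add: DirProd_def carrier_integer_mod_group)
  obtain a b where ab: "inv_into (carrier (zmod2 (l^n))) (\<phi> n) P = (a, b)" by fastforce
  have P: "P \<in> \<phi> n ` carrier (zmod2 (l^n))"
    unfolding carr bij_betw_imp_surj_on[OF tate_basis_bij] using assms by simp
  have "\<phi> n (a, b) = P" using f_inv_into_f[OF P] ab by simp
  moreover have "(a, b) \<in> {0..<int (l^n)} \<times> {0..<int (l^n)}" using inv_into_into[OF P] ab carr by simp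
  ultimately have "P = tate_point l \<phi> n a b" by (simp add: tate_point_def)
  then show ?thesis using ab by (rule that)
qed

lemma tate_point_add:
  "curve_add E (tate_point l \<phi> n a b) (tate_point l \<phi> n a' b') = tate_point l \<phi> n (a + a') (b + b')"
proof -
  have "\<phi> n \<in> hom (zmod2 (l^n)) (torsion_group E (l^n))" using basis by (simp add: tate_basis_def iso_def)
  moreover have "(a mod int (l^n), b mod int (l^n)) \<in> carrier (zmod2 (l^n))" for a b
    using l by (simp add: DirProd_def carrier_integer_mod_group)
  ultimately have "\<phi> n ((a mod int (l^n), b mod int (l^n)) \<otimes>\<^bsub>zmod2 (l^n)\<^esub> (a' mod int (l^n), b' mod int (l^n)))
    = tate_point l \<phi> n a b \<otimes>\<^bsub>torsion_group E (l^n)\<^esub> tate_point l \<phi> n a' b'"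
    unfolding tate_point_def by (intro hom_mult)
  then show ?thesis
    by (simp add: torsion_group_def DirProd_def tate_point_def mod_add_eq)
qed

lemma tate_point_0: "tate_point l \<phi> n 0 0 = Infinity"
  using tate_point_add[of n 0 0 0 0] by (intro curve_add_self_eq) simp

lemma tate_point_pow:
  "tate_point l \<phi> n a b [^]\<^bsub>curve_group E\<^esub> (k::nat) = tate_point l \<phi> n (int k * a) (int k * b)"
  by (induction k) (simp_all add: tate_point_0 tate_point_add algebra_simps)

lemma tate_point_neg: "curve_neg E (tate_point l \<phi> n a b) = tate_point l \<phi> n (- a) (- b)"
proof -
  have "curve_add E (tate_point l \<phi> n a b) (tate_point l \<phi> n (- a) (- b)) = Infinity"
    by (simp add: tate_point_add tate_point_0)
  then show ?thesis by (simp add: curve_add_eq_Infinity_iff)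
qed

lemma tate_point_int_pow:
  "tate_point l \<phi> n a b [^]\<^bsub>curve_group E\<^esub> (k::int) = tate_point l \<phi> n (k * a) (k * b)"
  by (simp add: int_pow_def2 tate_point_pow curve_inv on_curve_tate_point tate_point_neg)

text \<open>As \<open>\<sigma>\<close> fixes \<open>E\<close>, it is additive on the torsion and
  thus determined by the images of the two basis points, which are the columns of
  \<open>rho_mod\<close>.\<close>

lemma galois_tate_point:
  assumes \<sigma>: "field_aut \<sigma>" and E: "map_weierstrass \<sigma> E = E"
  shows "map_ell_point \<sigma> (tate_point l \<phi> n x y) =
    tate_point l \<phi> n (rho_mod l \<phi> n \<sigma> $ 1 $ 1 * x + rho_mod l \<phi> n \<sigma> $ 1 $ 2 * y)
      (rho_mod l \<phi> n \<sigma> $ 2 $ 1 * x + rho_mod l \<phi> n \<sigma> $ 2 $ 2 * y)"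
proof -
  have torsion: "on_curve E (map_ell_point \<sigma> (tate_point l \<phi> n a b))"
    "map_ell_point \<sigma> (tate_point l \<phi> n a b) [^]\<^bsub>curve_group E\<^esub> (l^n) = Infinity" for a b
    using on_curve_map[OF \<sigma>, where E = E] curve_pow_map[OF \<sigma>, where E = E] tate_point_torsion by (simp_all add: E)
  obtain a c where ac: "map_ell_point \<sigma> (tate_point l \<phi> n 1 0) = tate_point l \<phi> n a c"
      "inv_into (carrier (zmod2 (l^n))) (\<phi> n) (map_ell_point \<sigma> (tate_point l \<phi> n 1 0)) = (a, c)"
    using tate_point_surj[OF torsion] by metis
  obtain b d where bd: "map_ell_point \<sigma> (tate_point l \<phi> n 0 1) = tate_point l \<phi> n b d"
      "inv_into (carrier (zmod2 (l^n))) (\<phi> n) (map_ell_point \<sigma> (tate_point l \<phi> n 0 1)) = (b, d)"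
    using tate_point_surj[OF torsion] by metis
  \<comment> \<open>The reduction inside \<open>tate_point\<close> produces the same
    \<open>1 mod l^n\<close> as in \<open>rho_mod\<close>, which covers \<open>n = 0\<close> as
    well.\<close>
  have rho: "rho_mod l \<phi> n \<sigma> = vector [vector [a, b], vector [c, d]]"
    using ac(2) bd(2) by (simp add: rho_mod_def tate_point_def)
  have add_map: "map_ell_point \<sigma> (curve_add E P Q) = curve_add E (map_ell_point \<sigma> P) (map_ell_point \<sigma> Q)"
    for P Q using curve_add_map[OF \<sigma>, of E P Q] by (simp add: E)
  have pow_map: "map_ell_point \<sigma> (P [^]\<^bsub>curve_group E\<^esub> k) = map_ell_point \<sigma> P [^]\<^bsub>curve_group E\<^esub> k"
    for P and k :: nat using curve_pow_map[OF \<sigma>, where E = E] by (simp add: E)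
  \<comment> \<open>Nonnegative representatives turn the linear combination into natural multiples,
    with which \<open>\<sigma>\<close> commutes by \<open>pow_map\<close>.\<close>
  define i where "i = nat (x mod int (l^n))"
  define j where "j = nat (y mod int (l^n))"
  have ij: "int i = x mod int (l^n)" "int j = y mod int (l^n)" using l by (simp_all add: i_def j_def)
  have "tate_point l \<phi> n x y = curve_add E (tate_point l \<phi> n 1 0 [^]\<^bsub>curve_group E\<^esub> i)
      (tate_point l \<phi> n 0 1 [^]\<^bsub>curve_group E\<^esub> j)"
    by (simp add: tate_point_pow tate_point_add ij) (simp add: tate_point_def)
  then have "map_ell_point \<sigma> (tate_point l \<phi> n x y) = curve_add E (tate_point l \<phi> n a c [^]\<^bsub>curve_group E\<^esub> i)
      (tate_point l \<phi> n b d [^]\<^bsub>curve_group E\<^esub> j)"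
    by (simp only: add_map pow_map ac(1) bd(1))
  also have "\<dots> = tate_point l \<phi> n (int i * a + int j * b) (int i * c + int j * d)"
    by (simp add: tate_point_pow tate_point_add)
  also have "\<dots> = tate_point l \<phi> n (a * x + b * y) (c * x + d * y)"
  proof -
    have "(int i * a + int j * b) mod int (l^n) = (a * x + b * y) mod int (l^n)" for a b
      unfolding ij by (intro mod_add_cong) (simp_all add: mod_mult_right_eq mult.commute)
    then show ?thesis unfolding tate_point_def by simp
  qed
  finally show ?thesis by (simp add: rho)
qed

end

subsection \<open>Lifting matrices\<close>

lemma coprime_imp_inverse:
  fixes a :: int
  assumes "coprime a N"
  obtains k where "N dvd k * a - 1"
proof -
  obtain k v where "k * a + v * N = gcd a N" using bezout_int by blast
  then have "k * a - 1 = N * (- v)" using assms by (simp add: algebra_simps)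
  then show ?thesis using that[of k] by simp
qed

lemma coprime_if_dvd_diff_1: "N dvd a - 1 \<Longrightarrow> coprime a (N :: int)"
proof (rule coprimeI)
  fix c assume N: "N dvd a - 1" and c: "c dvd a" "c dvd N"
  have "c dvd a - (a - 1)" by (rule dvd_diff[OF c(1) dvd_trans[OF c(2) N]])
  moreover have "a - (a - 1) = 1" by simp
  ultimately show "is_unit c" by (simp only:)
qed

lemma prime_int_not_dvd_coprime: "prime (l::int) \<Longrightarrow> \<not> l dvd a \<Longrightarrow> coprime a l"
  using prime_imp_coprime coprime_commute by blast

text \<open>Since \<open>u1\<close> is a unit modulo \<open>l\<close>, the congruence can be
  improved from \<open>l^m\<close> to \<open>l^Suc m\<close> by correcting the first column. For
  \<open>m > 0\<close> the correction is divisible by \<open>l\<close> and the determinant stays a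
  unit. For \<open>m = 0\<close> the old matrix imposes no condition, and an invertible matrix is
  built from scratch, which is possible because the target is primitive.\<close>

lemma lift_matrix_aux:
  fixes l :: int
  assumes l: "prime l" and u: "coprime u1 l" and t: "\<not> (l dvd t1 \<and> l dvd t2)" and n: "coprime n l"
    and det: "coprime (a * d - b * c) l"
    and 1: "l^m dvd n * (a * u1 + b * u2) - t1" and 2: "l^m dvd n * (c * u1 + d * u2) - t2"
  obtains a' b' c' d' where "l^m dvd a' - a" "l^m dvd b' - b" "l^m dvd c' - c" "l^m dvd d' - d"
    "coprime (a' * d' - b' * c') l"
    "l^Suc m dvd n * (a' * u1 + b' * u2) - t1" "l^Suc m dvd n * (c' * u1 + d' * u2) - t2"
proof -
  obtain k where k: "l dvd k * u1 - 1" using coprime_imp_inverse[OF u] .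
  \<comment> \<open>Dividing by \<open>n\<close> modulo \<open>l^Suc m\<close> moves the scalar to
    the target vector.\<close>
  have "coprime n (l^Suc m)" using n by simp
  then obtain n' where n': "l^Suc m dvd n' * n - 1" using coprime_imp_inverse by blast
  have lift: "l^Suc m dvd n * z - t" if "l^Suc m dvd z - n' * t" for z t
  proof -
    have "n * z - t = n * (z - n' * t) + (n' * n - 1) * t" by (simp add: algebra_simps)
    then show ?thesis using that n' by simp
  qed
  show ?thesis
  proof (cases m)
    case 0
    have "coprime (n' * n) l" using n' 0 by (intro coprime_if_dvd_diff_1) simp
    then have n'l: "coprime n' l" by simp
    have "coprime (k * u1) l" using k by (rule coprime_if_dvd_diff_1)
    then have kl: "coprime k l" by simp
    \<comment> \<open>The second column is the standard basis vector that makes the determinant with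
      \<open>(t1, t2)\<close> equal to \<open>t1\<close> or \<open>- t2\<close>, whichever is known
      to be prime to \<open>l\<close>.\<close>
    define b' where "b' = (if l dvd t1 then 1 else 0 :: int)"
    define d' where "d' = (if l dvd t1 then 0 else 1 :: int)"
    have "coprime (t1 * d' - t2 * b') l"
      using t prime_int_not_dvd_coprime[OF l] by (cases "l dvd t1") (simp_all add: b'_def d'_def)
    then have det': "coprime (k * n' * (t1 * d' - t2 * b')) l" using kl n'l by simp
    have *: "l^Suc m dvd (k * (n' * t - u2 * e)) * u1 + e * u2 - n' * t" for t e
    proof -
      have "(k * (n' * t - u2 * e)) * u1 + e * u2 - n' * t = (k * u1 - 1) * (n' * t - u2 * e)"
        by (simp add: algebra_simps)
      then show ?thesis using k 0 by simp
    qed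
    show ?thesis
    proof (rule that[of "k * (n' * t1 - u2 * b')" b' "k * (n' * t2 - u2 * d')" d'])
      have "k * (n' * t1 - u2 * b') * d' - b' * (k * (n' * t2 - u2 * d')) = k * n' * (t1 * d' - t2 * b')"
        by (simp add: algebra_simps)
      then show "coprime (k * (n' * t1 - u2 * b') * d' - b' * (k * (n' * t2 - u2 * d'))) l"
        using det' by simp
    qed (use lift[OF *] 0 in simp_all)
  next
    case (Suc m')
    have n'm: "l^m dvd n' * n - 1" using n' by (rule power_le_dvd) simp
    have div_l: "\<exists>w. n' * t - z = l^m * w" if "l^m dvd n * z - t" for z t
    proof -
      have "n' * t - z = (n' * n - 1) * z - n' * (n * z - t)" by (simp add: algebra_simps)
      then have "l^m dvd n' * t - z" using that n'm by simp
      then show ?thesis by (auto simp: dvd_def)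
    qed
    obtain w1 where w1: "n' * t1 - (a * u1 + b * u2) = l^m * w1" using div_l[OF 1] by blast
    obtain w2 where w2: "n' * t2 - (c * u1 + d * u2) = l^m * w2" using div_l[OF 2] by blast
    \<comment> \<open>The remaining error is \<open>l^m * w\<close>; as \<open>k\<close> inverts
      \<open>u1\<close> modulo \<open>l\<close>, adding \<open>l^m * w * k\<close> to the
      first-column entry removes it modulo \<open>l^Suc m\<close>.\<close>
    have *: "l^Suc m dvd (x + l^m * w * k) * u1 + y * u2 - n' * t"
      if "n' * t - (x * u1 + y * u2) = l^m * w" for x y w t
    proof -
      have "(x + l^m * w * k) * u1 + y * u2 - n' * t = l^m * w * k * u1 - (n' * t - (x * u1 + y * u2))"
        by (simp add: algebra_simps)
      also have "\<dots> = l^m * (w * (k * u1 - 1))" unfolding that by (simp add: algebra_simps)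
      finally show ?thesis using k by (simp add: mult.commute[of l] mult_dvd_mono)
    qed
    show ?thesis
    proof (rule that[of "a + l^m * w1 * k" b "c + l^m * w2 * k" d])
      have "(a + l^m * w1 * k) * d - b * (c + l^m * w2 * k)
          = (a * d - b * c) + l * (l^m' * (w1 * k * d - b * w2 * k))"
        by (simp add: algebra_simps Suc)
      moreover have "coprime ((a * d - b * c) + l * z) l" for z
        using det by (metis coprime_iff_gcd_eq_1 gcd.commute gcd_add_mult mult.commute add.commute)
      ultimately show "coprime ((a + l^m * w1 * k) * d - b * (c + l^m * w2 * k)) l" by simp
    qed (use lift[OF *[OF w1]] lift[OF *[OF w2]] in simp_all)
  qed
qed

text \<open>A primitive vector has a coordinate prime to \<open>l\<close>. If it is the second one,
  exchange the two coordinates and the two columns, which only changes the sign of the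
  determinant.\<close>

lemma lift_matrix:
  fixes l :: int
  assumes l: "prime l" and u: "\<not> (l dvd u1 \<and> l dvd u2)" and t: "\<not> (l dvd t1 \<and> l dvd t2)"
    and n: "coprime n l" and det: "coprime (a * d - b * c) l"
    and 1: "l^m dvd n * (a * u1 + b * u2) - t1" and 2: "l^m dvd n * (c * u1 + d * u2) - t2"
  obtains a' b' c' d' where "l^m dvd a' - a" "l^m dvd b' - b" "l^m dvd c' - c" "l^m dvd d' - d"
    "coprime (a' * d' - b' * c') l"
    "l^Suc m dvd n * (a' * u1 + b' * u2) - t1" "l^Suc m dvd n * (c' * u1 + d' * u2) - t2"
proof (cases "l dvd u1")
  case False
  then have "coprime u1 l" by (rule prime_int_not_dvd_coprime[OF l])
  from lift_matrix_aux[OF l this t n det 1 2] show ?thesis using that by metis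
next
  case True
  then have u2: "coprime u2 l" using u by (intro prime_int_not_dvd_coprime[OF l]) simp
  have minus: "coprime (y - x) l \<longleftrightarrow> coprime (x - y) l" for x y
    using coprime_minus_left_iff[of "x - y" l] by simp
  have det': "coprime (b * c - a * d) l" using det minus by blast
  have h1: "l^m dvd n * (b * u2 + a * u1) - t1" and h2: "l^m dvd n * (d * u2 + c * u1) - t2"
    using 1 2 by (simp_all add: add.commute)
  obtain b' a' d' c' where *: "l^m dvd b' - b" "l^m dvd a' - a" "l^m dvd d' - d" "l^m dvd c' - c"
    "coprime (b' * c' - a' * d') l"
    "l^Suc m dvd n * (b' * u2 + a' * u1) - t1" "l^Suc m dvd n * (d' * u2 + c' * u1) - t2"
    by (rule lift_matrix_aux[OF l u2 t n det' h1 h2])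
  show ?thesis
  proof (rule that[of a' b' c' d'])
    show "coprime (a' * d' - b' * c') l" using *(5) minus by blast
  qed (use * in \<open>simp_all add: add.commute\<close>)
qed

subsection \<open>Full preimages\<close>

definition matrix22 :: "int \<Rightarrow> int \<Rightarrow> int \<Rightarrow> int \<Rightarrow> int^2^2" where
  "matrix22 a b c d = vector [vector [a, b], vector [c, d]]"

lemma matrix22_nth [simp]:
  "matrix22 a b c d $ 1 $ 1 = a" "matrix22 a b c d $ 1 $ 2 = b"
  "matrix22 a b c d $ 2 $ 1 = c" "matrix22 a b c d $ 2 $ 2 = d"
  by (simp_all add: matrix22_def)

lemma reduce_matrix_nth [simp]: "reduce_matrix N A $ i $ j = A $ i $ j mod int N"
  by (simp add: reduce_matrix_def)

lemma reduce_matrix_eq_iff: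
  "reduce_matrix N A = reduce_matrix N B \<longleftrightarrow> (\<forall>i j. int N dvd A $ i $ j - B $ i $ j)"
  by (simp add: vec_eq_iff mod_eq_dvd_iff)

lemma reduce_matrix_reduce_matrix:
  "N dvd M \<Longrightarrow> reduce_matrix N (reduce_matrix M A) = reduce_matrix N A"
  by (simp add: vec_eq_iff mod_mod_cancel)

lemma coprime_det_reduce_matrix:
  assumes "N > 0" "coprime (det A) (int N)"
  shows "coprime (det (reduce_matrix N A)) (int N)"
proof -
  have "det (reduce_matrix N A) mod int N = det A mod int N"
    unfolding det_2 reduce_matrix_nth by (intro mod_diff_cong mod_mult_cong mod_mod_trivial)
  then show ?thesis
    using assms coprime_mod_left_iff[of "int N" "det A"]
      coprime_mod_left_iff[of "int N" "det (reduce_matrix N A)"] by simp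
qed

text \<open>An integer matrix with determinant prime to \<open>l\<close> is an element of GL2 over
  the \<open>l\<close>-adic integers, so it suffices to construct integer matrices.\<close>

lemma reduce_matrix_in_GL2_adic:
  assumes "l > 0" "coprime (det A) (int l)"
  shows "(\<lambda>n. reduce_matrix (l^n) A) \<in> GL2_adic l"
proof -
  have "coprime (det (reduce_matrix (l^n) A)) (int (l^n))" for n
    using assms by (intro coprime_det_reduce_matrix) simp_all
  moreover have "reduce_matrix (l^n) (reduce_matrix (l^Suc n) A) = reduce_matrix (l^n) A" for n
    by (rule reduce_matrix_reduce_matrix) simp
  ultimately show ?thesis
    using assms(1) by (simp add: GL2_adic_def GL2_mod_def)
qed

lemma GL2_adic_reduce:
  assumes "A \<in> GL2_adic l" "d \<le> m"
  shows "reduce_matrix (l^d) (A m) = A d"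
  using assms(2)
proof (induction rule: dec_induct)
  case base
  have "\<forall>i j. A d $ i $ j \<in> {0..<int (l^d)}" using assms(1) unfolding GL2_adic_def GL2_mod_def by blast
  then show ?case by (simp add: vec_eq_iff)
next
  case (step m)
  have "reduce_matrix (l^m) (A (Suc m)) = A m" using assms(1) by (simp add: GL2_adic_def)
  then show ?case using step reduce_matrix_reduce_matrix[of "l^d" "l^m" "A (Suc m)"]
    by (simp add: le_imp_power_dvd)
qed

section \<open>Uniqueness of children from the level of the representation onwards\<close>

lemma closed_point_eq_of_children:
  fixes E :: "qbar weierstrass" and \<phi> :: "nat \<Rightarrow> int \<times> int \<Rightarrow> qbar ell_point"
  assumes ell: "elliptic_curve E" and no_CM: "\<not> has_CM E"
    and def_over: "defined_over E (adjoin (j_invariant E))"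
    and l: "prime l" and basis: "tate_basis E l \<phi>"
    and image: "rho_adic l \<phi> ` absolute_galois (adjoin (j_invariant E)) =
      {A \<in> GL2_adic l. A d \<in> rho_mod l \<phi> d ` absolute_galois (adjoin (j_invariant E))}"
    and "d \<le> m" and Q: "has_exact_order E Q (l^Suc m)" and Q': "has_exact_order E Q' (l^Suc m)"
    and eq: "closed_point E (Q [^]\<^bsub>curve_group E\<^esub> l) = closed_point E (Q' [^]\<^bsub>curve_group E\<^esub> l)"
  shows "closed_point E Q = closed_point E Q'"
proof -
  let ?K = "adjoin (j_invariant E)"
  let ?T = "tate_point l \<phi> (Suc m)"
  have l0: "l > 0" using l by (rule prime_gt_0_nat)
  have li: "prime (int l)" using l by simp
  have curve: "on_curve E Q" "on_curve E Q'" using Q Q' by (simp_all add: has_exact_order_def)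
  have fix_E: "map_weierstrass \<sigma> E = E" if "\<sigma> \<in> absolute_galois ?K" for \<sigma>
    using that def_over by (intro weierstrass.map_ident_strong) (auto simp: absolute_galois_iff defined_over_def)
  have "(E, Q' [^]\<^bsub>curve_group E\<^esub> l) \<in> closed_point E (Q [^]\<^bsub>curve_group E\<^esub> l)"
    unfolding eq by (intro closed_point_refl ell curve_pow_closed curve)
  then obtain \<sigma> f where \<sigma>: "field_aut \<sigma>" and f: "f \<in> ell_iso (map_weierstrass \<sigma> E) E"
      and f_eq: "f (map_ell_point \<sigma> (Q [^]\<^bsub>curve_group E\<^esub> l)) = Q' [^]\<^bsub>curve_group E\<^esub> l"
    unfolding closed_point_iff by blast
  have "j_invariant (map_weierstrass \<sigma> E) = j_invariant E"
    using f ell \<sigma> by (intro j_invariant_ell_iso) (simp_all add: elliptic_curve_map)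
  then have "\<sigma> (j_invariant E) = j_invariant E" by (simp add: j_invariant_map[OF \<sigma>])
  then have gal: "\<sigma> \<in> absolute_galois ?K" by (rule absolute_galois_adjoin[OF \<sigma>])
  have f: "f \<in> ell_iso E E" using f by (simp add: fix_E[OF gal])
  then have "f \<in> ell_hom E E" by (simp add: ell_iso_def)
  then obtain n :: int where n: "\<And>P. on_curve E P \<Longrightarrow> f P = P [^]\<^bsub>curve_group E\<^esub> n"
    using no_CM unfolding has_CM_def by auto
  have f_T: "f (?T a b) = ?T (n * a) (n * b)" for a b
    by (simp add: n on_curve_tate_point[OF l0 basis] tate_point_int_pow[OF l0 basis])
  note T_eq_iff = tate_point_eq_iff[OF l0 basis]
  have T_eq_Infinity: "?T a b = Infinity \<longleftrightarrow> int (l^Suc m) dvd a \<and> int (l^Suc m) dvd b" for a b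
    using T_eq_iff[of "Suc m" a b 0 0] by (simp add: tate_point_0[OF l0 basis])
  have dvd_Suc: "int (l^Suc m) dvd int (l^m) * z" if "int l dvd z" for z
    unfolding power_Suc2 of_nat_mult by (rule mult_dvd_mono[OF dvd_refl that])
  \<comment> \<open>Otherwise \<open>f\<close> would kill \<open>l^m\<close> times the first basis
    point of the \<open>l^Suc m\<close>-torsion, which is not \<open>Infinity\<close>.\<close>
  have n_coprime: "coprime n (int l)"
  proof (rule prime_int_not_dvd_coprime[OF li], rule notI)
    assume "int l dvd n"
    then have "int (l^Suc m) dvd n * int (l^m)" using dvd_Suc by (simp only: mult.commute)
    then have "f (?T (int (l^m)) 0) = Infinity"
      unfolding f_T T_eq_Infinity by (simp only: mult_zero_right dvd_0_right simp_thms)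
    then have "?T (int (l^m)) 0 = Infinity"
      using ell_iso_eq_Infinity_iff[OF f on_curve_tate_point[OF l0 basis]] by simp
    then have "l^Suc m dvd l^m" unfolding T_eq_Infinity by (simp only: int_dvd_int_iff)
    moreover have "l^m < l^Suc m" "0 < l^m" using prime_gt_1_nat[OF l] by simp_all
    ultimately show False by (meson dvd_imp_le leD)
  qed
  \<comment> \<open>If both coordinates were divisible by \<open>l\<close>, already the multiple by
    \<open>l^m\<close> would be trivial.\<close>
  have coords: "\<exists>a b. P = ?T a b \<and> \<not> (int l dvd a \<and> int l dvd b)" if "has_exact_order E P (l^Suc m)" for P
  proof -
    have P: "on_curve E P" "P [^]\<^bsub>curve_group E\<^esub> (l^Suc m) = Infinity"
      using that unfolding has_exact_order_def by simp_all
    obtain a b where ab: "P = ?T a b" by (rule tate_point_surj[OF l0 basis P])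
    have "l^m < l^Suc m" using prime_gt_1_nat[OF l] by simp
    then have "P [^]\<^bsub>curve_group E\<^esub> (l^m) \<noteq> Infinity"
      using that l0 unfolding has_exact_order_def by simp
    then have "\<not> (int (l^Suc m) dvd int (l^m) * a \<and> int (l^Suc m) dvd int (l^m) * b)"
      by (simp only: ab tate_point_pow[OF l0 basis] T_eq_Infinity not_False_eq_True)
    then have "\<not> (int l dvd a \<and> int l dvd b)" using dvd_Suc by blast
    then show ?thesis using ab by blast
  qed
  obtain u1 u2 where u: "Q = ?T u1 u2" "\<not> (int l dvd u1 \<and> int l dvd u2)" using coords[OF Q] by blast
  obtain t1 t2 where t: "Q' = ?T t1 t2" "\<not> (int l dvd t1 \<and> int l dvd t2)" using coords[OF Q'] by blast
  define M where "M = rho_mod l \<phi> (Suc m) \<sigma>"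
  have "f (map_ell_point \<sigma> (Q [^]\<^bsub>curve_group E\<^esub> l)) =
      ?T (n * (M $ 1 $ 1 * (int l * u1) + M $ 1 $ 2 * (int l * u2)))
        (n * (M $ 2 $ 1 * (int l * u1) + M $ 2 $ 2 * (int l * u2)))"
    by (simp only: u tate_point_pow[OF l0 basis] galois_tate_point[OF l0 basis \<sigma> fix_E[OF gal]] f_T M_def)
  moreover have "Q' [^]\<^bsub>curve_group E\<^esub> l = ?T (int l * t1) (int l * t2)"
    by (simp only: t tate_point_pow[OF l0 basis])
  ultimately have "?T (n * (M $ 1 $ 1 * (int l * u1) + M $ 1 $ 2 * (int l * u2)))
      (n * (M $ 2 $ 1 * (int l * u1) + M $ 2 $ 2 * (int l * u2))) = ?T (int l * t1) (int l * t2)"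
    using f_eq by (simp only:)
  then have dvd: "int (l^Suc m) dvd n * (M $ 1 $ 1 * (int l * u1) + M $ 1 $ 2 * (int l * u2)) - int l * t1"
      "int (l^Suc m) dvd n * (M $ 2 $ 1 * (int l * u1) + M $ 2 $ 2 * (int l * u2)) - int l * t2"
    by (simp_all only: T_eq_iff)
  \<comment> \<open>Only the multiples by \<open>l\<close> of \<open>Q\<close> and \<open>Q'\<close>
    are related so far. Cancelling that factor costs one power, leaving a congruence modulo
    \<open>l^m\<close>.\<close>
  have cancel: "int l ^ m dvd n * (x * u1 + y * u2) - t"
    if "int (l^Suc m) dvd n * (x * (int l * u1) + y * (int l * u2)) - int l * t" for x y t
  proof -
    have "n * (x * (int l * u1) + y * (int l * u2)) - int l * t = int l * (n * (x * u1 + y * u2) - t)"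
      by (simp add: algebra_simps)
    then show ?thesis using that l0 by simp
  qed
  have adic: "rho_adic l \<phi> \<sigma> \<in> GL2_adic l" using imageI[OF gal, of "rho_adic l \<phi>"] unfolding image by simp
  then have "M \<in> GL2_mod (l^Suc m)" unfolding M_def GL2_adic_def rho_adic_def by blast
  then have det_M: "coprime (M $ 1 $ 1 * M $ 2 $ 2 - M $ 1 $ 2 * M $ 2 $ 1) (int l)"
    by (simp add: GL2_mod_def det_2)
  obtain a b c e where B: "int l ^ m dvd a - M $ 1 $ 1" "int l ^ m dvd b - M $ 1 $ 2"
      "int l ^ m dvd c - M $ 2 $ 1" "int l ^ m dvd e - M $ 2 $ 2"
    and det_B: "coprime (a * e - b * c) (int l)"
    and Bu: "int l ^ Suc m dvd n * (a * u1 + b * u2) - t1" "int l ^ Suc m dvd n * (c * u1 + e * u2) - t2"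
    by (rule lift_matrix[OF li u(2) t(2) n_coprime det_M cancel[OF dvd(1)] cancel[OF dvd(2)]])
  define A where "A = (\<lambda>n. reduce_matrix (l^n) (matrix22 a b c e))"
  have "A \<in> GL2_adic l"
    unfolding A_def using det_B by (intro reduce_matrix_in_GL2_adic l0) (simp add: det_2)
  \<comment> \<open>The lift differs from \<open>M\<close> by multiples of \<open>l^m\<close>, hence
    of \<open>l^d\<close> as \<open>d \<le> m\<close>; so the hypothesis on the image makes it the
    matrix of some \<open>\<tau>\<close>.\<close>
  moreover have "A d = rho_mod l \<phi> d \<sigma>"
  proof -
    have "int (l^d) dvd z" if "int l ^ m dvd z" for z
      using dvd_trans[OF le_imp_power_dvd[OF \<open>d \<le> m\<close>] that] by simp
    then have "A d = reduce_matrix (l^d) M"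
      using B by (simp add: A_def reduce_matrix_eq_iff forall_2)
    also have "\<dots> = rho_mod l \<phi> d \<sigma>"
      using GL2_adic_reduce[OF adic, of d "Suc m"] \<open>d \<le> m\<close> by (simp add: rho_adic_def M_def)
    finally show ?thesis .
  qed
  ultimately have "A \<in> rho_adic l \<phi> ` absolute_galois ?K" using gal unfolding image by blast
  then obtain \<tau> where \<tau>: "\<tau> \<in> absolute_galois ?K" "rho_adic l \<phi> \<tau> = A" by blast
  have rho_\<tau>: "rho_mod l \<phi> (Suc m) \<tau> = reduce_matrix (l^Suc m) (matrix22 a b c e)"
    using fun_cong[OF \<tau>(2), of "Suc m", unfolded A_def rho_adic_def] .
  have aut: "field_aut \<tau>" using \<tau>(1) by (simp add: absolute_galois_iff)
  \<comment> \<open>The matrix of \<open>\<tau>\<close> has reduced entries, while the congruences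
    were obtained for the unreduced lift.\<close>
  have mod: "int (l^Suc m) dvd n * (x mod int (l^Suc m) * u1 + y mod int (l^Suc m) * u2) - t"
    if "int l ^ Suc m dvd n * (x * u1 + y * u2) - t" for x y t
  proof -
    let ?N = "int (l^Suc m)"
    have "n * (x mod ?N * u1 + y mod ?N * u2) - t =
      (n * (x * u1 + y * u2) - t) - ?N * (n * (x div ?N * u1 + y div ?N * u2))"
      unfolding minus_mult_div_eq_mod[symmetric] by (simp only: algebra_simps)
    moreover have "?N dvd n * (x * u1 + y * u2) - t" using that by simp
    ultimately show ?thesis by (simp only: dvd_diff dvd_triv_left)
  qed
  \<comment> \<open>The same \<open>f\<close> can be kept: \<open>\<tau>\<close> also fixes
    \<open>E\<close>, so \<open>f\<close> is an isomorphism from the conjugate by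
    \<open>\<tau>\<close> to \<open>E\<close>.\<close>
  have "f (map_ell_point \<tau> Q) = Q'"
    unfolding u t galois_tate_point[OF l0 basis aut fix_E[OF \<tau>(1)]] f_T T_eq_iff rho_\<tau>
    using mod[OF Bu(1)] mod[OF Bu(2)] by (simp only: reduce_matrix_nth matrix22_nth)
  then have "(E, Q') \<in> closed_point E Q"
    unfolding closed_point_iff using aut f ell curve fix_E[OF \<tau>(1)]
    by (intro conjI exI[of _ \<tau>] exI[of _ f]) simp_all
  from closed_point_eq[OF this ell curve(1)] show ?thesis ..
qed

text \<open>Lying over the root means that \<open>E\<close> is isomorphic to a conjugate of the
  given curve; the isomorphism transports the conjugated point to \<open>E\<close> within its closed
  point.\<close>

lemma X1_over_root:
  assumes ell: "elliptic_curve E" and "y \<in> X1 N" and "X1_map N y = closed_point E Infinity"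
  obtains Q where "y = closed_point E Q" "has_exact_order E Q N"
proof -
  obtain E1 Q1 where y: "y = closed_point E1 Q1" and E1: "elliptic_curve E1" "has_exact_order E1 Q1 N"
    using assms(2) unfolding X1_def by blast
  then have Q1: "on_curve E1 Q1" "Q1 [^]\<^bsub>curve_group E1\<^esub> N = Infinity"
    by (simp_all add: has_exact_order_def)
  have "(E, Infinity) \<in> closed_point E1 Infinity"
    using closed_point_refl[OF ell, of Infinity] assms(3) X1_map_closed_point[OF E1(1) Q1(1), of N]
    by (simp add: y Q1)
  then obtain \<sigma> f where \<sigma>: "field_aut \<sigma>" and f: "f \<in> ell_iso (map_weierstrass \<sigma> E1) E"
    unfolding closed_point_iff by blast
  have "on_curve E (f (map_ell_point \<sigma> Q1))"
    using ell_iso_hom[OF f] Q1(1) by (auto simp: hom_def Pi_iff on_curve_map[OF \<sigma>])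
  then have *: "(E, f (map_ell_point \<sigma> Q1)) \<in> closed_point E1 Q1"
    using \<sigma> f ell unfolding closed_point_iff by blast
  show ?thesis
  proof
    show "y = closed_point E (f (map_ell_point \<sigma> Q1))"
      using closed_point_eq[OF * E1(1) Q1(1)] by (simp add: y)
    show "has_exact_order E (f (map_ell_point \<sigma> Q1)) N"
      by (rule has_exact_order_closed_point[OF * E1(2)])
  qed
qed

lemma tree_children_unique:
  fixes E :: "qbar weierstrass" and \<phi> :: "nat \<Rightarrow> int \<times> int \<Rightarrow> qbar ell_point"
  assumes "elliptic_curve E" and "\<not> has_CM E"
    and "defined_over E (adjoin (j_invariant E))"
    and "prime l" and "tate_basis E l \<phi>"
    and "rho_adic l \<phi> ` absolute_galois (adjoin (j_invariant E)) =
      {A \<in> GL2_adic l. A d \<in> rho_mod l \<phi> d ` absolute_galois (adjoin (j_invariant E))}"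
    and "d \<le> m" and w: "w \<in> tree_children E l (m, x)" and w': "w' \<in> tree_children E l (m, x)"
  shows "w = w'"
proof -
  have child: "\<exists>Q. w = (Suc m, closed_point E Q) \<and> has_exact_order E Q (l^Suc m) \<and>
      closed_point E (Q [^]\<^bsub>curve_group E\<^esub> l) = x"
    if w: "w \<in> tree_children E l (m, x)" for w
  proof -
    obtain y where y: "w = (Suc m, y)" "y \<in> X1 (l^Suc m)" "X1_map (l^Suc m) y = closed_point E Infinity"
        "X1_map l y = x"
      using w by (auto simp: tree_children_def tree_verts_def)
    obtain Q where Q: "y = closed_point E Q" "has_exact_order E Q (l^Suc m)"
      using X1_over_root[OF assms(1) y(2,3)] .
    then have "X1_map l y = closed_point E (Q [^]\<^bsub>curve_group E\<^esub> l)"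
      using X1_map_closed_point[OF assms(1)] by (simp add: has_exact_order_def)
    then show ?thesis using y Q by blast
  qed
  obtain Q where Q: "w = (Suc m, closed_point E Q)" "has_exact_order E Q (l^Suc m)"
    "closed_point E (Q [^]\<^bsub>curve_group E\<^esub> l) = x" using child[OF w] by blast
  obtain Q' where Q': "w' = (Suc m, closed_point E Q')" "has_exact_order E Q' (l^Suc m)"
    "closed_point E (Q' [^]\<^bsub>curve_group E\<^esub> l) = x" using child[OF w'] by blast
  have "closed_point E Q = closed_point E Q'"
    by (rule closed_point_eq_of_children[OF assms(1-7) Q(2) Q'(2)]) (simp add: Q Q')
  then show ?thesis using Q Q' by simp
qed

theorem proposition6:
  fixes E :: "qbar weierstrass"
    and l :: nat
    and \<phi> :: "nat \<Rightarrow> int \<times> int \<Rightarrow> qbar ell_point"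
    and v :: "nat \<Rightarrow> vertex"
  assumes "elliptic_curve E"
    and "\<not> has_CM E"
    and "defined_over E (adjoin (j_invariant E))"
    and "prime l"
    and "tate_basis E l \<phi>"
    and "is_fiber E l v"
  shows "fiber_level E l v \<le> galois_level (adjoin (j_invariant E)) l \<phi>"
proof -
  have child: "v (Suc m) \<in> tree_children E l (v m)" for m
    using assms(6) by (simp add: is_fiber_def)
  \<comment> \<open>The position along the fiber is the exponent stored in the vertex, so the bound
    \<open>d \<le> m\<close> can be used for the children of \<open>v m\<close>.\<close>
  have level: "fst (v m) = m" for m
  proof (induction m)
    case 0
    then show ?case using assms(6) by (simp add: is_fiber_def tree_root_def)
  next
    case (Suc m)
    then show ?case using child[of m] by (auto simp: tree_children_def split: prod.splits)
  qed
  \<comment> \<open>Existence of a child is supplied by the fiber itself; only uniqueness depends on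
    the representation.\<close>
  have unique: "\<exists>!w. w \<in> tree_children E l (v m)"
    if image: "rho_adic l \<phi> ` absolute_galois (adjoin (j_invariant E)) =
      {A \<in> GL2_adic l. A d \<in> rho_mod l \<phi> d ` absolute_galois (adjoin (j_invariant E))}" and d: "d \<le> m"
    for d m
  proof (intro ex1I)
    show "v (Suc m) \<in> tree_children E l (v m)" by (rule child)
    obtain x where x: "v m = (m, x)" using level[of m] by (cases "v m") simp
    show "w = v (Suc m)" if w: "w \<in> tree_children E l (v m)" for w
      by (rule tree_children_unique[OF assms(1-5) image d w[unfolded x] child[of m, unfolded x]])
  qed
  show ?thesis
    unfolding fiber_level_def galois_level_def
  \<comment> \<open>Every exponent admissible for the representation is admissible for the fiber,
    and the infimum over the larger set is at most the other. An empty set on the Galois side gives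
    the value infinity, so that case is included.\<close>
  proof (intro Inf_superset_mono subsetI)
    fix x assume "x \<in> {enat (l^d) | d. rho_adic l \<phi> ` absolute_galois (adjoin (j_invariant E)) =
      {A \<in> GL2_adic l. A d \<in> rho_mod l \<phi> d ` absolute_galois (adjoin (j_invariant E))}}"
    then obtain d where x: "x = enat (l^d)" and image: "rho_adic l \<phi> ` absolute_galois (adjoin (j_invariant E)) =
      {A \<in> GL2_adic l. A d \<in> rho_mod l \<phi> d ` absolute_galois (adjoin (j_invariant E))}"
      unfolding mem_Collect_eq by (elim exE conjE)
    have "\<forall>m\<ge>d. \<exists>!w. w \<in> tree_children E l (v m)"
      by (intro allI impI unique[OF image])
    then show "x \<in> {enat (l^k) | k. \<forall>m\<ge>k. \<exists>!w. w \<in> tree_children E l (v m)}"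
      unfolding x mem_Collect_eq by (intro exI[of _ d] conjI refl)
  qed
qed

end
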